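(* Let $n\geq 2$ and let $\Bbbk$ be any (nontrivial) commutative ring. The double quiver of $\vec{\mathbb{A}}_n$, regarded as a stable translation quiver, is normal (relative to $\Bbbk$); that is, with $Q$ its mesh category over $\Bbbk$, the mesh homology satisfies $\mathscr{H}_q(Q(p,-))=0$ for all vertices $p,q$.
   Context: $\vec{\mathbb{A}}_n$ is the quiver with vertices $1,\dots,n$ and arrows $a_q\colon q\to q+1$ for $1\leq q<n$. Its double quiver has vertices $1,\dots,n$ and arrows $a_q\colon q\to q+1$ and $a_q^*\colon q+1\to q$ for $1\leq q<n$. It is a stable translation quiver with translation $\tau=\mathrm{id}$ and semitranslation $\sigma(a_q)=a_q^*$, $\sigma(a_q^* )=a_q$. The path category over $\Bbbk$ has the vertices as objects, and hom modules are the free $\Bbbk$-modules on the sets of paths (including trivial ones; paths are composed right to left). The mesh category $Q$ is the quotient of the path category by the two-sided ideal generated by $$\mu_1=a_1^*a_1,\qquad \mu_q=a_{q-1}a_{q-1}^*+a_q^*a_q\ (1<q<n),\qquad \mu_n=a_{n-1}a_{n-1}^*.$$ For a $\Bbbk$-linear functor $X$ from $Q$ to $\Bbbk$-modules and a vertex $q$, let $b_1\colon p_1\to q,\dots,b_m\colon p_m\to q$ be all the arrows with target $q$. The mesh homology $\mathscr{H}_q(X)$ is the homology (at the middle term) of the three term complex $$X(\tau(q))\xrightarrow{\ (X(\sigma(b_1)),\dots,X(\sigma(b_m)))^{t}\ }X(p_1)\oplus\cdots\oplus X(p_m)\xrightarrow{\ (X(b_1)\ \cdots\ X(b_m))\ }X(q).$$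 Explicitly, with $\tau(q)=q$: for $q=1$ the complex is $X(1)\to X(2)\to X(1)$ with maps $X(a_1),X(a_1^* )$; for $q=n$ it is $X(n)\to X(n-1)\to X(n)$ with maps $X(a_{n-1}^* ),X(a_{n-1})$; and for $1<q<n$ it is $X(q)\to X(q-1)\oplus X(q+1)\to X(q)$ with maps $(X(a_{q-1}^* ),X(a_q))^t$ and $(X(a_{q-1})\ X(a_q^* ))$. *)

theory Defs
  imports "HOL-Algebra.Algebra" "Graph_Theory.Arc_Walk"
begin

section \<open>Stable translation quivers\<close>

text \<open>
  Quivers are the multi-digraphs of Graph\_Theory.  Note that the list of arrows of a walk is in
  order of traversal, i.e. the path written \<open>b\<^sub>m \<dots> b\<^sub>1\<close> (composed right to left) is the list
  \<open>[b\<^sub>1, \<dots>, b\<^sub>m]\<close>; the composite \<open>v u\<close> is \<open>u @ v\<close>, and the trivial path at any vertex is \<open>[]\<close>.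
\<close>

record ('v, 'e) translation_quiver =
  quiver :: "('v, 'e) pre_digraph"
  trans :: "'v \<Rightarrow> 'v"
  semitrans :: "'e \<Rightarrow> 'e"

locale stable_translation_quiver =
  fixes \<Gamma> :: "('v, 'e) translation_quiver"
  assumes wf_quiver: "wf_digraph (quiver \<Gamma>)"
    and finite_in: "q \<in> verts (quiver \<Gamma>) \<Longrightarrow> finite (in_arcs (quiver \<Gamma>) q)"
    and finite_out: "q \<in> verts (quiver \<Gamma>) \<Longrightarrow> finite (out_arcs (quiver \<Gamma>) q)"
    and bij_trans: "bij_betw (trans \<Gamma>) (verts (quiver \<Gamma>)) (verts (quiver \<Gamma>))"
    and bij_semitrans: "bij_betw (semitrans \<Gamma>) (arcs (quiver \<Gamma>)) (arcs (quiver \<Gamma>))"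
    and tail_semitrans: "b \<in> arcs (quiver \<Gamma>) \<Longrightarrow>
      tail (quiver \<Gamma>) (semitrans \<Gamma> b) = trans \<Gamma> (head (quiver \<Gamma>) b)"
    and head_semitrans: "b \<in> arcs (quiver \<Gamma>) \<Longrightarrow>
      head (quiver \<Gamma>) (semitrans \<Gamma> b) = tail (quiver \<Gamma>) b"

definition paths :: "('v, 'e) pre_digraph \<Rightarrow> 'v \<Rightarrow> 'v \<Rightarrow> 'e list set" where
  "paths G p q = {w. pre_digraph.awalk G p w q}"

text \<open>The arrow \<open>a\<^sub>q: q \<rightarrow> q + 1\<close> is represented by the number \<open>q\<close>.\<close>

definition A_quiver :: "nat \<Rightarrow> (nat, nat) pre_digraph" where
  "A_quiver n = \<lparr>verts = {1..n}, arcs = {1..<n}, tail = (\<lambda>q. q), head = (\<lambda>q. q + 1)\<rparr>"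

datatype 'e double_arrow = Arr 'e | Star 'e

definition double_quiver :: "('v, 'e) pre_digraph \<Rightarrow> ('v, 'e double_arrow) translation_quiver" where
  "double_quiver G =
    \<lparr>quiver = \<lparr>verts = verts G,
               arcs = Arr ` arcs G \<union> Star ` arcs G,
               tail = (\<lambda>b. case b of Arr a \<Rightarrow> tail G a | Star a \<Rightarrow> head G a),
               head = (\<lambda>b. case b of Arr a \<Rightarrow> head G a | Star a \<Rightarrow> tail G a)\<rparr>,
     trans = (\<lambda>q. q),
     semitrans = (\<lambda>b. case b of Arr a \<Rightarrow> Star a | Star a \<Rightarrow> Arr a)\<rparr>"

lemma stable_translation_quiver_double:
  assumes "fin_digraph G"
  shows "stable_translation_quiver (double_quiver G)"
proof -
  interpret fin_digraph G by fact
  let ?s = "semitrans (double_quiver G)" and ?A = "arcs (quiver (double_quiver G))"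
  have fin: "finite ?A"
    by (simp add: double_quiver_def)
  have inv: "?s (?s b) = b" for b
    by (simp add: double_quiver_def split: double_arrow.split)
  have cl: "?s b \<in> ?A" if "b \<in> ?A" for b
    using that by (auto simp: double_quiver_def)
  show ?thesis
  proof
    show "bij_betw ?s ?A ?A"
      by (rule bij_betwI[where g = ?s]) (auto simp: inv cl)
    show "finite (in_arcs (quiver (double_quiver G)) q)"
      "finite (out_arcs (quiver (double_quiver G)) q)" for q
      using fin by (auto simp: in_arcs_def out_arcs_def)
  qed (auto simp: double_quiver_def bij_betw_def wf_digraph_def split: double_arrow.split)
qed

lemma fin_digraph_A_quiver: "fin_digraph (A_quiver n)"
  by unfold_locales (auto simp: A_quiver_def)


section \<open>Modules\<close>

text \<open>
  The HOL-Algebra record of modules extends that of rings; the locale \<open>module\<close> ignores the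
  multiplicative fields, which are left undefined here.
\<close>

definition free_module :: "('k, 'r) ring_scheme \<Rightarrow> 'b set \<Rightarrow> ('k, 'b \<Rightarrow> 'k) module" where
  "free_module R B =
    \<lparr>carrier = {f. (\<forall>x. f x \<in> carrier R) \<and> finite {x. f x \<noteq> \<zero>\<^bsub>R\<^esub>} \<and> {x. f x \<noteq> \<zero>\<^bsub>R\<^esub>} \<subseteq> B},
     monoid.mult = undefined, monoid.one = undefined,
     ring.zero = (\<lambda>x. \<zero>\<^bsub>R\<^esub>), ring.add = (\<lambda>f g x. f x \<oplus>\<^bsub>R\<^esub> g x),
     module.smult = (\<lambda>r f x. r \<otimes>\<^bsub>R\<^esub> f x)\<rparr>"

definition free_gen :: "('k, 'r) ring_scheme \<Rightarrow> 'b \<Rightarrow> 'b \<Rightarrow> 'k" where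
  "free_gen R x = (\<lambda>y. if y = x then \<one>\<^bsub>R\<^esub> else \<zero>\<^bsub>R\<^esub>)"

lemma free_module_module:
  assumes "cring R"
  shows "module R (free_module R B)"
proof -
  interpret cring R by fact
  let ?M = "free_module R B"
  have supp_add: "finite {x. f x \<oplus>\<^bsub>R\<^esub> g x \<noteq> \<zero>\<^bsub>R\<^esub>} \<and> {x. f x \<oplus>\<^bsub>R\<^esub> g x \<noteq> \<zero>\<^bsub>R\<^esub>} \<subseteq> B"
    if "f \<in> carrier ?M" "g \<in> carrier ?M" for f g
  proof -
    have "{x. f x \<oplus>\<^bsub>R\<^esub> g x \<noteq> \<zero>\<^bsub>R\<^esub>} \<subseteq> {x. f x \<noteq> \<zero>\<^bsub>R\<^esub>} \<union> {x. g x \<noteq> \<zero>\<^bsub>R\<^esub>}"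
      by auto
    with that show ?thesis
      by (auto simp: free_module_def intro: finite_subset)
  qed
  have supp_smult: "finite {x. h (f x) \<noteq> \<zero>\<^bsub>R\<^esub>} \<and> {x. h (f x) \<noteq> \<zero>\<^bsub>R\<^esub>} \<subseteq> B"
    if "f \<in> carrier ?M" "h \<zero>\<^bsub>R\<^esub> = \<zero>\<^bsub>R\<^esub>" for f and h :: "'a \<Rightarrow> 'a"
  proof -
    have "{x. h (f x) \<noteq> \<zero>\<^bsub>R\<^esub>} \<subseteq> {x. f x \<noteq> \<zero>\<^bsub>R\<^esub>}"
      using that(2) by auto
    with that show ?thesis
      by (auto simp: free_module_def intro: finite_subset)
  qed
  show ?thesis
  proof (rule moduleI)
    show "abelian_group ?M"
    proof (rule abelian_groupI)
      fix f assume f: "f \<in> carrier ?M"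
      have "(\<lambda>x. \<ominus>\<^bsub>R\<^esub> f x) \<in> carrier ?M"
        using f supp_smult[OF f, of "\<lambda>x. \<ominus>\<^bsub>R\<^esub> x"] by (simp add: free_module_def)
      moreover have "(\<lambda>x. \<ominus>\<^bsub>R\<^esub> f x) \<oplus>\<^bsub>?M\<^esub> f = \<zero>\<^bsub>?M\<^esub>"
        using f by (simp add: free_module_def l_neg)
      ultimately show "\<exists>g \<in> carrier ?M. g \<oplus>\<^bsub>?M\<^esub> f = \<zero>\<^bsub>?M\<^esub>"
        by blast
    next
      fix f g assume "f \<in> carrier ?M" "g \<in> carrier ?M"
      then show "f \<oplus>\<^bsub>?M\<^esub> g \<in> carrier ?M"
        using supp_add[of f g] by (simp add: free_module_def)
    qed (auto simp: free_module_def a_assoc a_comm a_lcomm)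
  next
    fix r f assume "r \<in> carrier R" "f \<in> carrier ?M"
    then show "r \<odot>\<^bsub>?M\<^esub> f \<in> carrier ?M"
      using supp_smult[of f "\<lambda>x. r \<otimes>\<^bsub>R\<^esub> x"] by (simp add: free_module_def)
  qed (auto simp: free_module_def l_distr r_distr m_assoc assms)
qed

definition quot_module :: "('k, 'm) module \<Rightarrow> 'm set \<Rightarrow> ('k, 'm set) module" where
  "quot_module M N =
    \<lparr>carrier = a_rcosets\<^bsub>M\<^esub> N,
     monoid.mult = undefined, monoid.one = undefined,
     ring.zero = N, ring.add = set_add M,
     module.smult = (\<lambda>r A. \<Union>x\<in>A. N +>\<^bsub>M\<^esub> (r \<odot>\<^bsub>M\<^esub> x))\<rparr>"

text \<open>Only used for finite index sets, where the direct sum is the direct product.\<close>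

definition fin_direct_sum :: "'i set \<Rightarrow> ('i \<Rightarrow> ('k, 'm) module) \<Rightarrow> ('k, 'i \<Rightarrow> 'm) module" where
  "fin_direct_sum I M =
    \<lparr>carrier = (\<Pi>\<^sub>E i\<in>I. carrier (M i)),
     monoid.mult = undefined, monoid.one = undefined,
     ring.zero = (\<lambda>i\<in>I. \<zero>\<^bsub>M i\<^esub>), ring.add = (\<lambda>x y. \<lambda>i\<in>I. x i \<oplus>\<^bsub>M i\<^esub> y i),
     module.smult = (\<lambda>r x. \<lambda>i\<in>I. r \<odot>\<^bsub>M i\<^esub> x i)\<rparr>"

text \<open>The homology at \<open>M\<close> of a complex \<open>L \<rightarrow> M \<rightarrow> N\<close> with maps \<open>f\<close> and \<open>g\<close>.\<close>

definition homology ::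
  "('k, 'l) module \<Rightarrow> ('l \<Rightarrow> 'm) \<Rightarrow> ('k, 'm) module \<Rightarrow> ('m \<Rightarrow> 'n) \<Rightarrow> ('k, 'n) module
    \<Rightarrow> ('k, 'm set) module" where
  "homology L f M g N = quot_module (M\<lparr>carrier := a_kernel M N g\<rparr>) (f ` carrier L)"

definition zero_module :: "('k, 'm) module \<Rightarrow> bool" where
  "zero_module M \<longleftrightarrow> carrier M = {\<zero>\<^bsub>M\<^esub>}"


section \<open>Linear categories\<close>

text \<open>
  \<open>Comp C p q r g f\<close> is the composite of \<open>f: p \<rightarrow> q\<close> and \<open>g: q \<rightarrow> r\<close>.
\<close>

record ('o, 'k, 'm) lin_cat =
  Ob :: "'o set"
  Hom :: "'o \<Rightarrow> 'o \<Rightarrow> ('k, 'm) module"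
  Comp :: "'o \<Rightarrow> 'o \<Rightarrow> 'o \<Rightarrow> 'm \<Rightarrow> 'm \<Rightarrow> 'm"
  Ident :: "'o \<Rightarrow> 'm"

text \<open>
  Functors to modules: \<open>FMor F p q f\<close> is the map \<open>FOb F p \<rightarrow> FOb F q\<close> induced by \<open>f: p \<rightarrow> q\<close>.
\<close>

record ('o, 'm, 'k, 'x) module_functor =
  FOb :: "'o \<Rightarrow> ('k, 'x) module"
  FMor :: "'o \<Rightarrow> 'o \<Rightarrow> 'm \<Rightarrow> 'x \<Rightarrow> 'x"

definition hom_functor :: "('o, 'k, 'm) lin_cat \<Rightarrow> 'o \<Rightarrow> ('o, 'm, 'k, 'm) module_functor" where
  "hom_functor C p = \<lparr>FOb = (\<lambda>q. Hom C p q), FMor = (\<lambda>q r g f. Comp C p q r g f)\<rparr>"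

definition two_sided_ideal ::
  "('k, 'r) ring_scheme \<Rightarrow> ('o, 'k, 'm) lin_cat \<Rightarrow> ('o \<Rightarrow> 'o \<Rightarrow> 'm set) \<Rightarrow> bool" where
  "two_sided_ideal R C I \<longleftrightarrow>
    (\<forall>p\<in>Ob C. \<forall>q\<in>Ob C. submodule (I p q) R (Hom C p q)) \<and>
    (\<forall>p\<in>Ob C. \<forall>q\<in>Ob C. \<forall>r\<in>Ob C. \<forall>f\<in>I p q. \<forall>g\<in>carrier (Hom C q r). Comp C p q r g f \<in> I p r) \<and>
    (\<forall>p\<in>Ob C. \<forall>q\<in>Ob C. \<forall>r\<in>Ob C. \<forall>f\<in>carrier (Hom C p q). \<forall>g\<in>I q r. Comp C p q r g f \<in> I p r)"

definition ideal_generated ::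
  "('k, 'r) ring_scheme \<Rightarrow> ('o, 'k, 'm) lin_cat \<Rightarrow> ('o \<Rightarrow> 'o \<Rightarrow> 'm set) \<Rightarrow> 'o \<Rightarrow> 'o \<Rightarrow> 'm set" where
  "ideal_generated R C S p q =
    \<Inter> {I p q | I. two_sided_ideal R C I \<and> (\<forall>p\<in>Ob C. \<forall>q\<in>Ob C. S p q \<subseteq> I p q)}"

definition quot_cat ::
  "('o, 'k, 'm) lin_cat \<Rightarrow> ('o \<Rightarrow> 'o \<Rightarrow> 'm set) \<Rightarrow> ('o, 'k, 'm set) lin_cat" where
  "quot_cat C I =
    \<lparr>Ob = Ob C,
     Hom = (\<lambda>p q. quot_module (Hom C p q) (I p q)),
     Comp = (\<lambda>p q r B A. \<Union>g\<in>B. \<Union>f\<in>A. I p r +>\<^bsub>Hom C p r\<^esub> Comp C p q r g f),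
     Ident = (\<lambda>p. I p p +>\<^bsub>Hom C p p\<^esub> Ident C p)\<rparr>"

text \<open>
  Composition in the path category is the bilinear extension of the composition of paths: the
  coefficient of a path \<open>w\<close> in \<open>g f\<close> is the sum over all factorizations of \<open>w\<close> as a path \<open>u\<close>
  followed by a path \<open>v\<close>.
\<close>

definition path_cat ::
  "('k, 'r) ring_scheme \<Rightarrow> ('v, 'e) pre_digraph \<Rightarrow> ('v, 'k, 'e list \<Rightarrow> 'k) lin_cat" where
  "path_cat R G =
    \<lparr>Ob = verts G,
     Hom = (\<lambda>p q. free_module R (paths G p q)),
     Comp = (\<lambda>p q r g f w. \<Oplus>\<^bsub>R\<^esub>z\<in>{(u, v). u @ v = w}. g (snd z) \<otimes>\<^bsub>R\<^esub> f (fst z)),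
     Ident = (\<lambda>p. free_gen R [])\<rparr>"


section \<open>Mesh categories and mesh homology\<close>

text \<open>
  The mesh relation at \<open>q\<close> is the sum of \<open>b \<sigma>(b): \<tau>(q) \<rightarrow> q\<close> over all arrows \<open>b\<close> with target \<open>q\<close>.
\<close>

definition mesh_rel ::
  "('k, 'r) ring_scheme \<Rightarrow> ('v, 'e) translation_quiver \<Rightarrow> 'v \<Rightarrow> 'e list \<Rightarrow> 'k" where
  "mesh_rel R \<Gamma> q =
    (\<Oplus>\<^bsub>Hom (path_cat R (quiver \<Gamma>)) (trans \<Gamma> q) q\<^esub> b\<in>in_arcs (quiver \<Gamma>) q.
      free_gen R [semitrans \<Gamma> b, b])"

definition mesh_ideal ::
  "('k, 'r) ring_scheme \<Rightarrow> ('v, 'e) translation_quiver \<Rightarrow> 'v \<Rightarrow> 'v \<Rightarrow> ('e list \<Rightarrow> 'k) set" where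
  "mesh_ideal R \<Gamma> = ideal_generated R (path_cat R (quiver \<Gamma>))
    (\<lambda>p q. if p = trans \<Gamma> q then {mesh_rel R \<Gamma> q} else {})"

definition mesh_cat ::
  "('k, 'r) ring_scheme \<Rightarrow> ('v, 'e) translation_quiver \<Rightarrow> ('v, 'k, ('e list \<Rightarrow> 'k) set) lin_cat" where
  "mesh_cat R \<Gamma> = quot_cat (path_cat R (quiver \<Gamma>)) (mesh_ideal R \<Gamma>)"

definition mesh_arrow ::
  "('k, 'r) ring_scheme \<Rightarrow> ('v, 'e) translation_quiver \<Rightarrow> 'e \<Rightarrow> ('e list \<Rightarrow> 'k) set" where
  "mesh_arrow R \<Gamma> b =
    (let p = tail (quiver \<Gamma>) b; q = head (quiver \<Gamma>) b
     in mesh_ideal R \<Gamma> p q +>\<^bsub>Hom (path_cat R (quiver \<Gamma>)) p q\<^esub> free_gen R [b])"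

text \<open>The map \<open>F(b)\<close> for an arrow \<open>b\<close> and a functor \<open>F\<close> on the mesh category.\<close>

definition arrow_map ::
  "('k, 'r) ring_scheme \<Rightarrow> ('v, 'e) translation_quiver
    \<Rightarrow> ('v, ('e list \<Rightarrow> 'k) set, 'k, 'x) module_functor \<Rightarrow> 'e \<Rightarrow> 'x \<Rightarrow> 'x" where
  "arrow_map R \<Gamma> F b =
    FMor F (tail (quiver \<Gamma>) b) (head (quiver \<Gamma>) b) (mesh_arrow R \<Gamma> b)"

definition mesh_homology ::
  "('k, 'r) ring_scheme \<Rightarrow> ('v, 'e) translation_quiver
    \<Rightarrow> ('v, ('e list \<Rightarrow> 'k) set, 'k, 'x) module_functor \<Rightarrow> 'v \<Rightarrow> ('k, ('e \<Rightarrow> 'x) set) module" where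
  "mesh_homology R \<Gamma> F q =
    homology
      (FOb F (trans \<Gamma> q))
      (\<lambda>x. \<lambda>b\<in>in_arcs (quiver \<Gamma>) q. arrow_map R \<Gamma> F (semitrans \<Gamma> b) x)
      (fin_direct_sum (in_arcs (quiver \<Gamma>) q) (\<lambda>b. FOb F (tail (quiver \<Gamma>) b)))
      (\<lambda>y. \<Oplus>\<^bsub>FOb F q\<^esub> b\<in>in_arcs (quiver \<Gamma>) q. arrow_map R \<Gamma> F b (y b))
      (FOb F q)"

definition normal_quiver :: "('k, 'r) ring_scheme \<Rightarrow> ('v, 'e) translation_quiver \<Rightarrow> bool" where
  "normal_quiver R \<Gamma> \<longleftrightarrow>
    (\<forall>p\<in>verts (quiver \<Gamma>). \<forall>q\<in>verts (quiver \<Gamma>).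
      zero_module (mesh_homology R \<Gamma> (hom_functor (mesh_cat R \<Gamma>) p) q))"

end

theory Submission
  imports Defs
begin

text \<open>
  The mesh relations identify, up to sign, all paths from \<open>p\<close> to \<open>q\<close> with the same number \<open>m\<close> of
  downward arrows: straightening brings each of them to the form \<open>down\<^sup>m\<close> followed by \<open>up\<^sup>k\<close>, where
  \<open>k = q + m - p\<close>. The class is zero if \<open>m \<ge> p\<close> or \<open>q + m > n\<close>, since the path can then be rerouted
  through the mesh relation at \<open>1\<close> or at \<open>n\<close>. The signed coefficient sums at the remaining \<open>m\<close> are
  well defined on the mesh category (their common kernel is a two-sided ideal containing the mesh
  relations), so these classes form a basis of \<open>Q(p, q)\<close>. In this basis the arrows act, up to sign,
  as partial shifts of \<open>(m, k)\<close>, and exactness of the mesh complex can be checked coordinatewise.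
\<close>

subsection \<open>Free modules and path convolution\<close>

text \<open>The mesh ideal is given as an intersection: membership follows from closure properties,
  but nothing can be read off a member. Hence it is enclosed from both sides. \<open>J\<close> is
  one of the ideals being intersected, which bounds \<open>I\<close> from above; straightening, done
  inside \<open>I\<close>, bounds it from below. Two facts make the coordinates respect composition.
  With fixed ends, the number of downward arrows determines the number of upward ones, so the sign
  gained by joining two paths depends only on their ends and on these numbers. And the range m < p,
  q + m \<le> n passes to both factors of a composite, because q + m is p plus the number of upward
  arrows. Every nonzero scalar in the rewriting is a sign, hence its own inverse, so the argument is
  uniform in the ring.\<close>

context cring
begin

lemma free_module_fields [simp]:
  "\<zero>\<^bsub>free_module R B\<^esub> = (\<lambda>x. \<zero>)"
  "f \<oplus>\<^bsub>free_module R B\<^esub> g = (\<lambda>x. f x \<oplus> g x)"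
  "c \<odot>\<^bsub>free_module R B\<^esub> f = (\<lambda>x. c \<otimes> f x)"
  by (simp_all add: free_module_def)

lemma free_module_carrierI:
  assumes "\<And>x. f x \<in> carrier R" "finite A" "A \<subseteq> B" "\<And>x. x \<notin> A \<Longrightarrow> f x = \<zero>"
  shows "f \<in> carrier (free_module R B)"
proof -
  have "{x. f x \<noteq> \<zero>} \<subseteq> A"
    using assms(4) by auto
  then show ?thesis
    using assms finite_subset[of "{x. f x \<noteq> \<zero>}" A] by (auto simp: free_module_def)
qed

lemma free_module_carrierD:
  assumes "f \<in> carrier (free_module R B)"
  shows "f x \<in> carrier R" "finite {x. f x \<noteq> \<zero>}" "x \<notin> B \<Longrightarrow> f x = \<zero>"
  using assms by (auto simp: free_module_def)

lemma free_module_closed: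
  assumes "f \<in> carrier (free_module R B)"
  shows "g \<in> carrier (free_module R B) \<Longrightarrow> (\<lambda>x. f x \<oplus> g x) \<in> carrier (free_module R B)"
    and "c \<in> carrier R \<Longrightarrow> (\<lambda>x. c \<otimes> f x) \<in> carrier (free_module R B)"
proof -
  interpret M: module R "free_module R B"
    by (rule free_module_module) (rule is_cring)
  show "(\<lambda>x. f x \<oplus> g x) \<in> carrier (free_module R B)" if "g \<in> carrier (free_module R B)"
    using M.add.m_closed[OF assms that] by simp
  show "(\<lambda>x. c \<otimes> f x) \<in> carrier (free_module R B)" if "c \<in> carrier R"
    using M.smult_closed[OF that assms] by simp
qed

lemma free_module_zero: "(\<lambda>x. \<zero>) \<in> carrier (free_module R B)"
  by (rule free_module_carrierI[where A = "{}"]) auto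

lemma free_gen_closed [simp]: "free_gen R x y \<in> carrier R"
  by (simp add: free_gen_def)

lemma free_gen_carrier: "x \<in> B \<Longrightarrow> free_gen R x \<in> carrier (free_module R B)"
  by (rule free_module_carrierI[where A = "{x}"]) (auto simp: free_gen_def)

lemma free_module_uminus:
  assumes "f \<in> carrier (free_module R B)"
  shows "\<ominus>\<^bsub>free_module R B\<^esub> f = (\<lambda>x. \<ominus> f x)"
proof -
  interpret M: module R "free_module R B"
    by (rule free_module_module) (rule is_cring)
  have "\<ominus>\<^bsub>free_module R B\<^esub> f = (\<ominus> \<one>) \<odot>\<^bsub>free_module R B\<^esub> f"
    using M.smult_l_minus[of \<one> f] assms M.smult_one[OF assms] by simp
  then show ?thesis
    using free_module_carrierD(1)[OF assms] by (simp add: l_minus)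
qed

lemma free_module_submoduleI:
  assumes "N \<subseteq> carrier (free_module R B)" "(\<lambda>x. \<zero>) \<in> N"
    and add: "\<And>f g. f \<in> N \<Longrightarrow> g \<in> N \<Longrightarrow> (\<lambda>x. f x \<oplus> g x) \<in> N"
    and smult: "\<And>c f. c \<in> carrier R \<Longrightarrow> f \<in> N \<Longrightarrow> (\<lambda>x. c \<otimes> f x) \<in> N"
  shows "submodule N R (free_module R B)"
proof -
  interpret M: module R "free_module R B"
    by (rule free_module_module) (rule is_cring)
  show ?thesis
  proof (rule M.submoduleI)
    fix f assume f: "f \<in> N"
    then have fc: "f \<in> carrier (free_module R B)"
      using assms(1) by blast
    have "\<ominus>\<^bsub>free_module R B\<^esub> f = (\<lambda>x. (\<ominus> \<one>) \<otimes> f x)"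
      using free_module_carrierD(1)[OF fc] by (simp add: free_module_uminus[OF fc] l_minus)
    then show "\<ominus>\<^bsub>free_module R B\<^esub> f \<in> N"
      using smult[OF _ f, of "\<ominus> \<one>"] by simp
  qed (use assms in auto)
qed

text \<open>Lets linear claims, such as the absorption laws of \<open>J\<close> and the
  straightening of arbitrary elements, be checked on single paths.\<close>

lemma free_module_induct [consumes 1, case_names zero add smult gen]:
  assumes f: "f \<in> carrier (free_module R B)"
    and zero: "P (\<lambda>x. \<zero>)"
    and add: "\<And>f g. f \<in> carrier (free_module R B) \<Longrightarrow> g \<in> carrier (free_module R B)
      \<Longrightarrow> P f \<Longrightarrow> P g \<Longrightarrow> P (\<lambda>x. f x \<oplus> g x)"
    and smult: "\<And>c f. c \<in> carrier R \<Longrightarrow> f \<in> carrier (free_module R B)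
      \<Longrightarrow> P f \<Longrightarrow> P (\<lambda>x. c \<otimes> f x)"
    and gen: "\<And>x. x \<in> B \<Longrightarrow> P (free_gen R x)"
  shows "P f"
proof -
  \<comment> \<open>The induction runs over a finite superset of the support, so that a point where
    f already vanishes can simply be dropped.\<close>
  have "P f" if "finite S" "{x. f x \<noteq> \<zero>} \<subseteq> S" "f \<in> carrier (free_module R B)" for S f
    using that
  proof (induction S arbitrary: f rule: finite_induct)
    case empty
    then have "f = (\<lambda>x. \<zero>)"
      by auto
    then show ?case
      using zero by simp
  next
    case (insert a S)
    note fD = free_module_carrierD[OF insert.prems(2)]
    show ?case
    proof (cases "f a = \<zero>")
      case True
      then show ?thesis
        using insert by (metis (mono_tags, lifting) mem_Collect_eq subset_insert)
    next
      case False
      then have a: "a \<in> B"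
        using fD(3) by blast
      define g where "g = f(a := \<zero>)"
      have supp: "{x. g x \<noteq> \<zero>} \<subseteq> {x. f x \<noteq> \<zero>}"
        by (auto simp: g_def)
      have g: "g \<in> carrier (free_module R B)"
        by (rule free_module_carrierI[where A = "{x. g x \<noteq> \<zero>}"])
          (use fD finite_subset[OF supp] in \<open>auto simp: g_def\<close>)
      have "P g"
        by (rule insert.IH[OF _ g]) (use insert.prems(1) in \<open>auto simp: g_def\<close>)
      moreover have "P (\<lambda>x. f a \<otimes> free_gen R a x)"
        by (rule smult) (use fD a gen free_gen_carrier in auto)
      ultimately have "P (\<lambda>x. g x \<oplus> f a \<otimes> free_gen R a x)"
        using add g free_module_closed(2)[OF free_gen_carrier[OF a] fD(1)] by blast
      also have "(\<lambda>x. g x \<oplus> f a \<otimes> free_gen R a x) = f"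
        using fD(1) by (auto simp: g_def free_gen_def)
      finally show ?thesis .
    qed
  qed
  from this[of "{x. f x \<noteq> \<zero>}" f] show ?thesis
    using f free_module_carrierD(2)[OF f] by auto
qed

text \<open>Composition in the path category without its typing: being defined on all lists, it
  obeys the bilinearity laws as soon as the values lie in the ring. Endpoints enter only with
  \<open>conv_carrier\<close>.\<close>

definition conv :: "('e list \<Rightarrow> 'a) \<Rightarrow> ('e list \<Rightarrow> 'a) \<Rightarrow> 'e list \<Rightarrow> 'a" where
  "conv g f = (\<lambda>w. \<Oplus>z\<in>{(u, v). u @ v = w}. g (snd z) \<otimes> f (fst z))"

lemma finite_splits: "finite {(u, v). u @ v = w}"
proof -
  have "z \<in> (\<lambda>i. (take i w, drop i w)) ` {..length w}" if "z \<in> {(u, v). u @ v = w}" for z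
    by (rule image_eqI[where x = "length (fst z)"]) (use that in auto)
  then have "{(u, v). u @ v = w} \<subseteq> (\<lambda>i. (take i w, drop i w)) ` {..length w}"
    by blast
  then show ?thesis
    by (rule finite_subset) simp
qed

lemma conv_closed:
  "(\<And>x. g x \<in> carrier R) \<Longrightarrow> (\<And>x. f x \<in> carrier R) \<Longrightarrow> conv g f w \<in> carrier R"
  unfolding conv_def by (rule finsum_closed) auto

lemma conv_add_left:
  assumes "\<And>x. g x \<in> carrier R" "\<And>x. h x \<in> carrier R" "\<And>x. f x \<in> carrier R"
  shows "conv (\<lambda>x. g x \<oplus> h x) f = (\<lambda>x. conv g f x \<oplus> conv h f x)"
  unfolding conv_def
  by (rule ext, subst finsum_addf[symmetric]) (auto simp: assms l_distr)

lemma conv_add_right: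
  assumes "\<And>x. g x \<in> carrier R" "\<And>x. h x \<in> carrier R" "\<And>x. f x \<in> carrier R"
  shows "conv f (\<lambda>x. g x \<oplus> h x) = (\<lambda>x. conv f g x \<oplus> conv f h x)"
  unfolding conv_def
  by (rule ext, subst finsum_addf[symmetric]) (auto simp: assms r_distr)

lemma conv_smult_left:
  assumes "c \<in> carrier R" "\<And>x. g x \<in> carrier R" "\<And>x. f x \<in> carrier R"
  shows "conv (\<lambda>x. c \<otimes> g x) f = (\<lambda>x. c \<otimes> conv g f x)"
  unfolding conv_def
  by (rule ext, subst finsum_rdistr) (auto simp: assms m_assoc finite_splits)

lemma conv_smult_right:
  assumes "c \<in> carrier R" "\<And>x. g x \<in> carrier R" "\<And>x. f x \<in> carrier R"
  shows "conv g (\<lambda>x. c \<otimes> f x) = (\<lambda>x. c \<otimes> conv g f x)"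
  unfolding conv_def
  by (rule ext, subst finsum_rdistr) (auto simp: assms m_lcomm finite_splits)

lemma conv_zero [simp]:
  "(\<And>x. f x \<in> carrier R) \<Longrightarrow> conv (\<lambda>x. \<zero>) f = (\<lambda>x. \<zero>)"
  "(\<And>x. f x \<in> carrier R) \<Longrightarrow> conv f (\<lambda>x. \<zero>) = (\<lambda>x. \<zero>)"
  by (simp_all add: conv_def)

lemma conv_eq_zero:
  assumes "\<And>x. g x \<in> carrier R" "\<And>x. f x \<in> carrier R"
    and "\<And>u v. u @ v = w \<Longrightarrow> g v = \<zero> \<or> f u = \<zero>"
  shows "conv g f w = \<zero>"
proof -
  have "conv g f w = (\<Oplus>z\<in>{(u, v). u @ v = w}. \<zero>)"
    unfolding conv_def
  proof (rule finsum_cong')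
    fix z assume "z \<in> {(u, v). u @ v = w}"
    then have "g (snd z) = \<zero> \<or> f (fst z) = \<zero>"
      using assms(3)[of "fst z" "snd z"] by auto
    then show "g (snd z) \<otimes> f (fst z) = \<zero>"
      using assms(1,2) by auto
  qed auto
  then show ?thesis
    by simp
qed

text \<open>Meant for composition with a generator on either side, where cancellation leaves one
  split that can contribute.\<close>

lemma conv_eq_single:
  assumes "\<And>x. g x \<in> carrier R" "\<And>x. f x \<in> carrier R"
    and "\<And>u' v'. u' @ v' = u @ v \<Longrightarrow> (u', v') \<noteq> (u, v) \<Longrightarrow> g v' = \<zero> \<or> f u' = \<zero>"
  shows "conv g f (u @ v) = g v \<otimes> f u"
proof -
  have "conv g f (u @ v) = (\<Oplus>z\<in>{(u, v)}. g (snd z) \<otimes> f (fst z))"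
    unfolding conv_def
  proof (rule add.finprod_mono_neutral_cong_right)
    fix z assume "z \<in> {(u', v'). u' @ v' = u @ v} - {(u, v)}"
    then have "g (snd z) = \<zero> \<or> f (fst z) = \<zero>"
      using assms(3)[of "fst z" "snd z"] by auto
    then show "g (snd z) \<otimes> f (fst z) = \<zero>"
      using assms(1,2) by auto
  qed (use assms(1,2) in \<open>auto simp: finite_splits\<close>)
  then show ?thesis
    using assms by simp
qed

lemma conv_gen_left:
  assumes "\<And>x. f x \<in> carrier R"
  shows "conv (free_gen R v) f (u @ v) = f u"
  by (subst conv_eq_single) (use assms in \<open>auto simp: free_gen_def\<close>)

lemma conv_gen_left_zero:
  assumes "\<And>x. f x \<in> carrier R" "\<And>u. w \<noteq> u @ v"
  shows "conv (free_gen R v) f w = \<zero>"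
  by (rule conv_eq_zero) (use assms in \<open>auto simp: free_gen_def\<close>)

lemma conv_gen_right:
  assumes "\<And>x. g x \<in> carrier R"
  shows "conv g (free_gen R u) (u @ v) = g v"
  by (subst conv_eq_single) (use assms in \<open>auto simp: free_gen_def\<close>)

lemma conv_gen_right_zero:
  assumes "\<And>x. g x \<in> carrier R" "\<And>v. w \<noteq> u @ v"
  shows "conv g (free_gen R u) w = \<zero>"
  by (rule conv_eq_zero) (use assms in \<open>auto simp: free_gen_def\<close>)

lemma conv_gen_gen: "conv (free_gen R v) (free_gen R u) = free_gen R (u @ v)"
proof
  fix w
  show "conv (free_gen R v) (free_gen R u) w = free_gen R (u @ v) w"
  proof (cases "\<exists>u'. w = u' @ v")
    case True
    then obtain u' where "w = u' @ v"
      by blast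
    moreover have "free_gen R u u' = free_gen R (u @ v) (u' @ v)"
      by (simp add: free_gen_def)
    ultimately show ?thesis
      using conv_gen_left[of "free_gen R u" v u'] by simp
  next
    case False
    then show ?thesis
      using conv_gen_left_zero[of "free_gen R u" w v] by (auto simp: free_gen_def)
  qed
qed

lemma conv_carrier:
  assumes "g \<in> carrier (free_module R B)" "f \<in> carrier (free_module R A)"
    and "\<And>u v. u \<in> A \<Longrightarrow> v \<in> B \<Longrightarrow> u @ v \<in> C"
  shows "conv g f \<in> carrier (free_module R C)"
proof (rule free_module_carrierI)
  let ?S = "(\<lambda>(u, v). u @ v) ` ({x. f x \<noteq> \<zero>} \<times> {x. g x \<noteq> \<zero>})"
  note g = free_module_carrierD[OF assms(1)] and f = free_module_carrierD[OF assms(2)]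
  show "conv g f w \<in> carrier R" for w
    by (rule conv_closed) (fact g f)+
  show "finite ?S"
    using f g by simp
  show "?S \<subseteq> C"
    using f(3) g(3) assms(3) by auto
  show "conv g f w = \<zero>" if "w \<notin> ?S" for w
    by (rule conv_eq_zero) (use that f g in auto)
qed

end

subsection \<open>Quotient modules\<close>

text \<open>Fixes the type of M to the unextended record, the type on which
  \<open>quot_module\<close> is defined.\<close>

locale unit_module = module R M
  for R :: "('k, 'r) ring_scheme" and M :: "('k, 'm) module" (structure)
begin

lemma submodule_abelian_subgroup:
  assumes "submodule N R M"
  shows "abelian_subgroup N M"
  by (rule abelian_subgroupI3)
    (use assms in \<open>auto intro: additive_subgroup.intro submodule.axioms(1) abelian_group_axioms\<close>)

lemma coset_eq_iff:
  assumes N: "submodule N R M" and x: "x \<in> carrier M" and y: "y \<in> carrier M"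
  shows "N +>\<^bsub>M\<^esub> x = N +>\<^bsub>M\<^esub> y \<longleftrightarrow> x \<ominus>\<^bsub>M\<^esub> y \<in> N"
proof -
  interpret N: abelian_subgroup N M
    by (rule submodule_abelian_subgroup[OF N])
  have "x \<in> N +>\<^bsub>M\<^esub> x"
    using N.a_rcos_self x by blast
  then show ?thesis
    using N.a_rcos_module[OF y x] N.a_repr_independence'[OF _ y, of x] by (auto simp: a_minus_def)
qed

lemma quot_module_carrier: "carrier (quot_module M N) = (\<lambda>x. N +>\<^bsub>M\<^esub> x) ` carrier M"
  by (auto simp: quot_module_def A_RCOSETS_def')

lemma quot_module_add:
  assumes "submodule N R M" "x \<in> carrier M" "y \<in> carrier M"
  shows "(N +>\<^bsub>M\<^esub> x) \<oplus>\<^bsub>quot_module M N\<^esub> (N +>\<^bsub>M\<^esub> y) = N +>\<^bsub>M\<^esub> (x \<oplus>\<^bsub>M\<^esub> y)"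
  using abelian_subgroup.a_rcos_sum[OF submodule_abelian_subgroup] assms by (simp add: quot_module_def)

lemma quot_module_zero:
  assumes "submodule N R M"
  shows "\<zero>\<^bsub>quot_module M N\<^esub> = N +>\<^bsub>M\<^esub> \<zero>\<^bsub>M\<^esub>"
  using submoduleE(1)[OF assms] by (simp add: quot_module_def)

text \<open>An abelian monoid is the structure that finite sums in the quotient require.\<close>

lemma quot_module_abelian_monoid:
  assumes N: "submodule N R M"
  shows "abelian_monoid (quot_module M N)"
proof (rule abelian_monoidI)
  let ?Q = "quot_module M N"
  note [simp] = quot_module_carrier quot_module_add[OF N] quot_module_zero[OF N]
  show "\<zero>\<^bsub>?Q\<^esub> \<in> carrier ?Q"
    by auto
  fix A B assume A: "A \<in> carrier ?Q" and B: "B \<in> carrier ?Q"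
  then show "A \<oplus>\<^bsub>?Q\<^esub> B \<in> carrier ?Q" "A \<oplus>\<^bsub>?Q\<^esub> B = B \<oplus>\<^bsub>?Q\<^esub> A"
    by (auto simp: a_comm)
  show "(A \<oplus>\<^bsub>?Q\<^esub> B) \<oplus>\<^bsub>?Q\<^esub> C = A \<oplus>\<^bsub>?Q\<^esub> (B \<oplus>\<^bsub>?Q\<^esub> C)" if "C \<in> carrier ?Q" for C
    using A B that by (auto simp: a_assoc)
  show "\<zero>\<^bsub>?Q\<^esub> \<oplus>\<^bsub>?Q\<^esub> A = A"
    using A by auto
qed

lemma quot_module_finsum:
  assumes N: "submodule N R M" and "finite A" and "f \<in> A \<rightarrow> carrier M"
  shows "finsum (quot_module M N) (\<lambda>b. N +>\<^bsub>M\<^esub> f b) A = N +>\<^bsub>M\<^esub> finsum M f A"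
  using assms(2,3)
proof (induction A rule: finite_induct)
  case empty
  interpret Q: abelian_monoid "quot_module M N"
    by (rule quot_module_abelian_monoid[OF N])
  show ?case
    by (simp add: quot_module_zero[OF N])
next
  case (insert b A)
  interpret Q: abelian_monoid "quot_module M N"
    by (rule quot_module_abelian_monoid[OF N])
  have "finsum (quot_module M N) (\<lambda>b. N +>\<^bsub>M\<^esub> f b) (insert b A)
      = (N +>\<^bsub>M\<^esub> f b) \<oplus>\<^bsub>quot_module M N\<^esub> (N +>\<^bsub>M\<^esub> finsum M f A)"
    using insert by (subst Q.finsum_insert) (auto simp: quot_module_carrier)
  also have "\<dots> = N +>\<^bsub>M\<^esub> finsum M f (insert b A)"
    using insert by (simp add: quot_module_add[OF N] finsum_insert Pi_iff)
  finally show ?case .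
qed

end


subsection \<open>Mesh categories\<close>

lemma path_cat_simps [simp]:
  "Ob (path_cat R G) = verts G"
  "Hom (path_cat R G) p q = free_module R (paths G p q)"
  by (simp_all add: path_cat_def)

lemma (in cring) Comp_path_cat [simp]: "Comp (path_cat R G) p q r = conv"
  by (simp add: path_cat_def conv_def fun_eq_iff)

lemma ideal_generated_subset:
  "two_sided_ideal R C I \<Longrightarrow> (\<And>p q. p \<in> Ob C \<Longrightarrow> q \<in> Ob C \<Longrightarrow> S p q \<subseteq> I p q)
    \<Longrightarrow> ideal_generated R C S p q \<subseteq> I p q"
  unfolding ideal_generated_def by blast

lemma generator_in_ideal_generated:
  "p \<in> Ob C \<Longrightarrow> q \<in> Ob C \<Longrightarrow> f \<in> S p q \<Longrightarrow> f \<in> ideal_generated R C S p q"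
  unfolding ideal_generated_def by blast

locale mesh_quiver = cring R + stable_translation_quiver \<Gamma>
  for R :: "('k, 'r) ring_scheme" (structure) and \<Gamma> :: "('v, 'e) translation_quiver"
begin

abbreviation "V \<equiv> verts (quiver \<Gamma>)"
abbreviation "H p q \<equiv> free_module R (paths (quiver \<Gamma>) p q)"
abbreviation "I \<equiv> mesh_ideal R \<Gamma>"
abbreviation "cls p q f \<equiv> I p q +>\<^bsub>H p q\<^esub> f"

sublocale G: wf_digraph "quiver \<Gamma>"
  by (rule wf_quiver)

lemma H_module: "module R (H p q)"
  by (rule free_module_module) (rule is_cring)

lemma H_unit_module: "unit_module R (H p q)"
  by (rule unit_module.intro) (rule H_module)

lemma paths_append: "u \<in> paths (quiver \<Gamma>) p q \<Longrightarrow> v \<in> paths (quiver \<Gamma>) q r \<Longrightarrow> u @ v \<in> paths (quiver \<Gamma>) p r"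
  unfolding paths_def using G.awalk_appendI by blast

lemma paths_arrow: "b \<in> arcs (quiver \<Gamma>) \<Longrightarrow> [b] \<in> paths (quiver \<Gamma>) (tail (quiver \<Gamma>) b) (head (quiver \<Gamma>) b)"
  by (simp add: paths_def G.awalk_simps)

lemma conv_H: "g \<in> carrier (H q r) \<Longrightarrow> f \<in> carrier (H p q) \<Longrightarrow> conv g f \<in> carrier (H p r)"
  by (rule conv_carrier) (auto intro: paths_append)

lemma two_sided_ideal_Hom: "two_sided_ideal R (path_cat R (quiver \<Gamma>)) (\<lambda>p q. carrier (H p q))"
  unfolding two_sided_ideal_def
  using conv_H module.carrier_is_submodule[OF H_module] by auto

lemma two_sided_ideal_mesh: "two_sided_ideal R (path_cat R (quiver \<Gamma>)) I"
proof -
  let ?S = "\<lambda>p q. if p = trans \<Gamma> q then {mesh_rel R \<Gamma> q} else {}"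
  define K where "K = {I. two_sided_ideal R (path_cat R (quiver \<Gamma>)) I \<and> (\<forall>p\<in>V. \<forall>q\<in>V. ?S p q \<subseteq> I p q)}"
  have I_eq: "I p q = (\<Inter>I\<in>K. I p q)" for p q
    unfolding mesh_ideal_def ideal_generated_def K_def by auto
  have rel: "mesh_rel R \<Gamma> q \<in> carrier (H (trans \<Gamma> q) q)" if "q \<in> V" for q
  proof -
    interpret M: module R "H (trans \<Gamma> q) q"
      by (rule H_module)
    have "[semitrans \<Gamma> b, b] \<in> paths (quiver \<Gamma>) (trans \<Gamma> q) q" if b: "b \<in> in_arcs (quiver \<Gamma>) q" for b
    proof -
      have "semitrans \<Gamma> b \<in> arcs (quiver \<Gamma>)"
        using bij_semitrans b by (auto simp: bij_betw_def)
      then show ?thesis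
        using b paths_append[of "[semitrans \<Gamma> b]" _ _ "[b]"] paths_arrow[of b] paths_arrow[of "semitrans \<Gamma> b"]
          tail_semitrans[of b] head_semitrans[of b] by auto
    qed
    then show ?thesis
      unfolding mesh_rel_def path_cat_simps by (intro M.finsum_closed) (auto intro: free_gen_carrier)
  qed
  \<comment> \<open>The family of full hom modules shows that the intersection has a member to run
    over and hence stays inside the carriers.\<close>
  have K_Hom: "(\<lambda>p q. carrier (H p q)) \<in> K"
    using two_sided_ideal_Hom rel by (auto simp: K_def)
  have sub: "submodule (J p q) R (H p q)" if "J \<in> K" "p \<in> V" "q \<in> V" for J p q
    using that by (auto simp: K_def two_sided_ideal_def)
  have "submodule (I p q) R (H p q)" if "p \<in> V" "q \<in> V" for p q
  proof (rule free_module_submoduleI)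
    show "I p q \<subseteq> carrier (H p q)"
      using K_Hom by (auto simp: I_eq)
    show "(\<lambda>x. \<zero>) \<in> I p q"
      using subgroup.one_closed[OF submodule.axioms(1)[OF sub[OF _ that]]] by (auto simp: I_eq)
    show "(\<lambda>x. f x \<oplus> g x) \<in> I p q" if "f \<in> I p q" "g \<in> I p q" for f g
      using that module.submoduleE(5)[OF H_module sub[OF _ \<open>p \<in> V\<close> \<open>q \<in> V\<close>], of _ f g] by (auto simp: I_eq)
    show "(\<lambda>x. c \<otimes> f x) \<in> I p q" if "c \<in> carrier R" "f \<in> I p q" for c f
      using that module.submoduleE(4)[OF H_module sub[OF _ \<open>p \<in> V\<close> \<open>q \<in> V\<close>], of _ c f] by (auto simp: I_eq)
  qed
  moreover have "conv g f \<in> I p r" if "p \<in> V" "q \<in> V" "r \<in> V" "f \<in> I p q" "g \<in> carrier (H q r)" for p q r f g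
    using that unfolding I_eq by (auto simp: K_def two_sided_ideal_def)
  moreover have "conv g f \<in> I p r" if "p \<in> V" "q \<in> V" "r \<in> V" "f \<in> carrier (H p q)" "g \<in> I q r" for p q r f g
    using that unfolding I_eq by (auto simp: K_def two_sided_ideal_def)
  ultimately show ?thesis
    unfolding two_sided_ideal_def by auto
qed

lemma I_submodule: "p \<in> V \<Longrightarrow> q \<in> V \<Longrightarrow> submodule (I p q) R (H p q)"
  using two_sided_ideal_mesh by (simp add: two_sided_ideal_def)

lemma I_closed:
  assumes "p \<in> V" "q \<in> V"
  shows "f \<in> I p q \<Longrightarrow> f \<in> carrier (H p q)"
    and "(\<lambda>x. \<zero>) \<in> I p q"
    and "f \<in> I p q \<Longrightarrow> g \<in> I p q \<Longrightarrow> (\<lambda>x. f x \<oplus> g x) \<in> I p q"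
    and "c \<in> carrier R \<Longrightarrow> f \<in> I p q \<Longrightarrow> (\<lambda>x. c \<otimes> f x) \<in> I p q"
  using module.submoduleE[OF H_module I_submodule[OF assms]]
    subgroup.one_closed[OF submodule.axioms(1)[OF I_submodule[OF assms]]] by auto

lemma I_conv_left:
  "p \<in> V \<Longrightarrow> q \<in> V \<Longrightarrow> r \<in> V \<Longrightarrow> f \<in> I p q \<Longrightarrow> g \<in> carrier (H q r) \<Longrightarrow> conv g f \<in> I p r"
  using two_sided_ideal_mesh by (simp add: two_sided_ideal_def)

lemma I_conv_right:
  "p \<in> V \<Longrightarrow> q \<in> V \<Longrightarrow> r \<in> V \<Longrightarrow> f \<in> carrier (H p q) \<Longrightarrow> g \<in> I q r \<Longrightarrow> conv g f \<in> I p r"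
  using two_sided_ideal_mesh by (simp add: two_sided_ideal_def)

lemma trans_V: "q \<in> V \<Longrightarrow> trans \<Gamma> q \<in> V"
  using bij_trans by (auto simp: bij_betw_def)

lemma mesh_rel_in_I: "q \<in> V \<Longrightarrow> mesh_rel R \<Gamma> q \<in> I (trans \<Gamma> q) q"
  unfolding mesh_ideal_def by (rule generator_in_ideal_generated) (auto intro: trans_V)

lemma I_subset:
  assumes "two_sided_ideal R (path_cat R (quiver \<Gamma>)) J" "\<And>q. q \<in> V \<Longrightarrow> mesh_rel R \<Gamma> q \<in> J (trans \<Gamma> q) q"
  shows "I p q \<subseteq> J p q"
  unfolding mesh_ideal_def by (rule ideal_generated_subset) (use assms in auto)

lemma H_minus:
  assumes "f \<in> carrier (H p q)" "g \<in> carrier (H p q)"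
  shows "f \<ominus>\<^bsub>H p q\<^esub> g = (\<lambda>x. f x \<ominus> g x)"
  using assms by (simp add: a_minus_def free_module_uminus)

lemma cls_eq_iff:
  assumes "p \<in> V" "q \<in> V" "f \<in> carrier (H p q)" "g \<in> carrier (H p q)"
  shows "cls p q f = cls p q g \<longleftrightarrow> (\<lambda>x. f x \<ominus> g x) \<in> I p q"
  using unit_module.coset_eq_iff[OF H_unit_module I_submodule] assms by (simp add: H_minus)

lemma cls_memE:
  assumes "p \<in> V" "q \<in> V" "f \<in> carrier (H p q)" "g \<in> cls p q f"
  obtains h where "h \<in> I p q" "g = (\<lambda>x. h x \<oplus> f x)"
  using assms(4) by (auto simp: a_r_coset_def')

lemma cls_self:
  assumes "p \<in> V" "q \<in> V" "f \<in> carrier (H p q)"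
  shows "f \<in> cls p q f"
  using abelian_subgroup.a_rcos_self[OF unit_module.submodule_abelian_subgroup[OF H_unit_module I_submodule]] assms
  by blast

section \<open>Composition and mesh homology on representatives\<close>

lemma conv_cls:
  assumes "p \<in> V" "q \<in> V" "r \<in> V" "f \<in> carrier (H p q)" "g \<in> carrier (H q r)"
    and "f' \<in> cls p q f" "g' \<in> cls q r g"
  shows "cls p r (conv g' f') = cls p r (conv g f)"
proof -
  obtain h where h: "h \<in> I p q" "f' = (\<lambda>x. h x \<oplus> f x)"
    by (rule cls_memE[OF assms(1,2,4,6)])
  obtain k where k: "k \<in> I q r" "g' = (\<lambda>x. k x \<oplus> g x)"
    by (rule cls_memE[OF assms(2,3,5,7)])
  have hH: "h \<in> carrier (H p q)" and kH: "k \<in> carrier (H q r)"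
    using I_closed(1) h k assms by blast+
  note vals = free_module_carrierD(1)[OF hH] free_module_carrierD(1)[OF kH]
    free_module_carrierD(1)[OF assms(4)] free_module_carrierD(1)[OF assms(5)]
  have f'H: "f' \<in> carrier (H p q)" and g'H: "g' \<in> carrier (H q r)"
    using free_module_closed(1) hH kH assms h k by auto
  \<comment> \<open>Changing one factor at a time leaves two error terms, g h and k f', each of
    which is absorbed by one side of the ideal.\<close>
  have eq: "conv g' f' x = conv g h x \<oplus> conv k f' x \<oplus> conv g f x" for x
  proof -
    have "conv g' f' x = conv k f' x \<oplus> conv g f' x"
      unfolding k(2) using vals free_module_carrierD(1)[OF f'H] by (simp add: conv_add_left)
    also have "conv g f' x = conv g h x \<oplus> conv g f x"
      unfolding h(2) using vals by (simp add: conv_add_right)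
    finally show ?thesis
      using vals free_module_carrierD(1)[OF f'H] by (simp add: conv_closed a_ac)
  qed
  have "(\<lambda>x. conv g h x \<oplus> conv k f' x) \<in> I p r"
    by (rule I_closed(3)) (use assms h k f'H I_conv_left I_conv_right in auto)
  moreover have "(\<lambda>x. conv g' f' x \<ominus> conv g f x) = (\<lambda>x. conv g h x \<oplus> conv k f' x)"
  proof
    show "conv g' f' x \<ominus> conv g f x = conv g h x \<oplus> conv k f' x" for x
      unfolding eq using vals free_module_carrierD(1)[OF f'H]
      by (simp add: a_minus_def conv_closed a_assoc r_neg)
  qed
  ultimately show ?thesis
    using cls_eq_iff[OF assms(1,3) conv_H[OF g'H f'H] conv_H[OF assms(5,4)]] by simp
qed

text \<open>Composition of cosets is a union over all representatives. By \<open>conv_cls\<close>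
  every member of the union is the same coset, and the union is over nonempty sets.\<close>

lemma arrow_map_cls:
  assumes "p \<in> V" and b: "b \<in> arcs (quiver \<Gamma>)" and "f \<in> carrier (H p (tail (quiver \<Gamma>) b))"
  shows "arrow_map R \<Gamma> (hom_functor (mesh_cat R \<Gamma>) p) b (cls p (tail (quiver \<Gamma>) b) f)
    = cls p (head (quiver \<Gamma>) b) (conv (free_gen R [b]) f)"
proof -
  let ?s = "tail (quiver \<Gamma>) b" and ?t = "head (quiver \<Gamma>) b"
  have st: "?s \<in> V" "?t \<in> V"
    using b by auto
  have bH: "free_gen R [b] \<in> carrier (H ?s ?t)"
    by (rule free_gen_carrier) (rule paths_arrow[OF b])
  have "arrow_map R \<Gamma> (hom_functor (mesh_cat R \<Gamma>) p) b (cls p ?s f)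
    = (\<Union>g\<in>cls ?s ?t (free_gen R [b]). \<Union>f'\<in>cls p ?s f. cls p ?t (conv g f'))"
    by (simp add: arrow_map_def hom_functor_def mesh_cat_def quot_cat_def mesh_arrow_def Let_def)
  also have "\<dots> = (\<Union>g\<in>cls ?s ?t (free_gen R [b]). \<Union>f'\<in>cls p ?s f. cls p ?t (conv (free_gen R [b]) f))"
    using conv_cls[OF assms(1) st assms(3) bH] by auto
  also have "\<dots> = cls p ?t (conv (free_gen R [b]) f)"
    using cls_self[OF st bH] cls_self[OF assms(1) st(1) assms(3)] by blast
  finally show ?thesis .
qed

text \<open>Trades cosets for functions on paths: \<open>exact\<close> says that a family whose
  image lies in the ideal is, modulo the ideal, the image of some x.\<close>

lemma zero_mesh_homologyI:
  assumes p: "p \<in> V" and q: "q \<in> V"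
    and exact: "\<And>y. (\<And>b. b \<in> in_arcs (quiver \<Gamma>) q \<Longrightarrow> y b \<in> carrier (H p (tail (quiver \<Gamma>) b))) \<Longrightarrow>
      (\<Oplus>\<^bsub>H p q\<^esub>b\<in>in_arcs (quiver \<Gamma>) q. conv (free_gen R [b]) (y b)) \<in> I p q \<Longrightarrow>
      \<exists>x\<in>carrier (H p (trans \<Gamma> q)). \<forall>b\<in>in_arcs (quiver \<Gamma>) q.
        (\<lambda>w. y b w \<ominus> conv (free_gen R [semitrans \<Gamma> b]) x w) \<in> I p (tail (quiver \<Gamma>) b)"
  shows "zero_module (mesh_homology R \<Gamma> (hom_functor (mesh_cat R \<Gamma>) p) q)"
proof -
  let ?A = "in_arcs (quiver \<Gamma>) q" and ?F = "hom_functor (mesh_cat R \<Gamma>) p"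
  let ?t = "tail (quiver \<Gamma>)" and ?s = "semitrans \<Gamma>"
  let ?Q = "\<lambda>r. quot_module (H p r) (I p r)"
  let ?L = "FOb ?F (trans \<Gamma> q)"
  let ?D = "fin_direct_sum ?A (\<lambda>b. FOb ?F (?t b))"
  let ?f = "\<lambda>x. \<lambda>b\<in>?A. arrow_map R \<Gamma> ?F (?s b) x"
  let ?g = "\<lambda>y. \<Oplus>\<^bsub>FOb ?F q\<^esub> b\<in>?A. arrow_map R \<Gamma> ?F b (y b)"
  let ?K = "a_kernel ?D (FOb ?F q) ?g"
  let ?N = "?f ` carrier ?L"
  have FOb: "FOb ?F r = ?Q r" for r
    by (simp add: hom_functor_def mesh_cat_def quot_cat_def)
  have tV: "?t b \<in> V" and bA: "b \<in> arcs (quiver \<Gamma>)" "head (quiver \<Gamma>) b = q" if "b \<in> ?A" for b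
    using that by auto
  have sA: "?s b \<in> arcs (quiver \<Gamma>)" "?t (?s b) = trans \<Gamma> q" "head (quiver \<Gamma>) (?s b) = ?t b" if "b \<in> ?A" for b
    using bij_semitrans bA[OF that] tail_semitrans head_semitrans by (auto simp: bij_betw_def)
  have tq: "trans \<Gamma> q \<in> V"
    using q by (rule trans_V)
  have sH: "free_gen R [?s b] \<in> carrier (H (trans \<Gamma> q) (?t b))" if "b \<in> ?A" for b
    using paths_arrow[OF sA(1)[OF that]] sA[OF that] by (auto intro: free_gen_carrier)
  have bH: "free_gen R [b] \<in> carrier (H (?t b) q)" if "b \<in> ?A" for b
    using paths_arrow[OF bA(1)[OF that]] bA[OF that] by (auto intro: free_gen_carrier)
  \<comment> \<open>The first map of the complex, evaluated on the class of x.\<close>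
  define \<rho> where "\<rho> x = (\<lambda>b\<in>?A. cls p (?t b) (conv (free_gen R [?s b]) x))" for x
  have f_cls: "?f (cls p (trans \<Gamma> q) x) = \<rho> x" if "x \<in> carrier (H p (trans \<Gamma> q))" for x
    unfolding \<rho>_def using arrow_map_cls[OF p sA(1), of _ x] sA(2,3) that by (intro restrict_ext) auto
  have N: "?N = \<rho> ` carrier (H p (trans \<Gamma> q))"
    unfolding FOb unit_module.quot_module_carrier[OF H_unit_module] image_image using f_cls by (rule image_cong[OF refl])
  have \<rho>_add: "\<rho> x \<oplus>\<^bsub>?D\<^esub> \<rho> y = \<rho> (\<lambda>w. x w \<oplus> y w)"
    if x: "x \<in> carrier (H p (trans \<Gamma> q))" and y: "y \<in> carrier (H p (trans \<Gamma> q))" for x y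
  proof -
    have "cls p (?t b) (conv (free_gen R [?s b]) x) \<oplus>\<^bsub>?Q (?t b)\<^esub> cls p (?t b) (conv (free_gen R [?s b]) y)
      = cls p (?t b) (conv (free_gen R [?s b]) (\<lambda>w. x w \<oplus> y w))" if b: "b \<in> ?A" for b
      using unit_module.quot_module_add[OF H_unit_module I_submodule[OF p tV[OF b]] conv_H[OF sH[OF b] x] conv_H[OF sH[OF b] y]]
        free_module_carrierD(1)[OF x] free_module_carrierD(1)[OF y]
      by (simp add: conv_add_right)
    then show ?thesis
      by (simp add: fin_direct_sum_def \<rho>_def FOb cong: restrict_cong)
  qed
  have K_sub: "?K \<subseteq> ?N"
  proof
    fix y assume y: "y \<in> ?K"
    have yD: "y \<in> (\<Pi>\<^sub>E b\<in>?A. carrier (?Q (?t b)))" and gy: "?g y = I p q"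
      using y unfolding a_kernel_def kernel_def FOb by (auto simp: fin_direct_sum_def quot_module_def)
    have "\<exists>z. z \<in> carrier (H p (?t b)) \<and> y b = cls p (?t b) z" if "b \<in> ?A" for b
    proof -
      have "y b \<in> carrier (?Q (?t b))"
        using yD that by blast
      then show ?thesis
        unfolding unit_module.quot_module_carrier[OF H_unit_module] by blast
    qed
    then obtain z where z: "\<And>b. b \<in> ?A \<Longrightarrow> z b \<in> carrier (H p (?t b)) \<and> y b = cls p (?t b) (z b)"
      by metis
    interpret M: unit_module R "H p q"
      by (rule H_unit_module)
    interpret Q: abelian_monoid "?Q q"
      by (rule M.quot_module_abelian_monoid[OF I_submodule[OF p q]])
    let ?S = "\<Oplus>\<^bsub>H p q\<^esub>b\<in>?A. conv (free_gen R [b]) (z b)"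
    have zH: "(\<lambda>b. conv (free_gen R [b]) (z b)) \<in> ?A \<rightarrow> carrier (H p q)"
      using conv_H[OF bH] z by auto
    have arr: "arrow_map R \<Gamma> ?F b (y b) = cls p q (conv (free_gen R [b]) (z b))" if b: "b \<in> ?A" for b
      using arrow_map_cls[OF p bA(1)[OF b], of "z b"] z[OF b] bA(2)[OF b] by simp
    have "?g y = (\<Oplus>\<^bsub>?Q q\<^esub>b\<in>?A. cls p q (conv (free_gen R [b]) (z b)))"
      unfolding FOb using arr zH
      by (intro Q.finsum_cong') (auto simp: M.quot_module_carrier)
    also have "\<dots> = cls p q ?S"
      by (rule M.quot_module_finsum[OF I_submodule[OF p q] finite_in[OF q] zH])
    finally have "cls p q ?S = I p q"
      using gy by simp
    moreover have "?S \<in> cls p q ?S"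
      by (rule cls_self[OF p q]) (rule M.finsum_closed[OF zH])
    ultimately have "?S \<in> I p q"
      by simp
    with exact[of z] z obtain x where x: "x \<in> carrier (H p (trans \<Gamma> q))"
      and zx: "\<And>b. b \<in> ?A \<Longrightarrow> (\<lambda>w. z b w \<ominus> conv (free_gen R [?s b]) x w) \<in> I p (?t b)"
      by blast
    have "y = \<rho> x"
    proof
      fix b
      show "y b = \<rho> x b"
      proof (cases "b \<in> ?A")
        case True
        then show ?thesis
          using cls_eq_iff[OF p tV[OF True]] z[OF True] zx[OF True] conv_H[OF sH[OF True] x]
          by (simp add: \<rho>_def)
      next
        case False
        then show ?thesis
          using PiE_arb[OF yD False] by (auto simp: \<rho>_def)
      qed
    qed
    then show "y \<in> ?N"
      using x unfolding N by blast
  qed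
  \<comment> \<open>The homology consists of the cosets N + a with a in the kernel. As the kernel
    lies in N, each of them is N itself once N is closed under addition and subtraction.\<close>
  have shift: "(\<Union>h\<in>?N. {h \<oplus>\<^bsub>?D\<^esub> a}) = ?N" if a: "a \<in> ?N" for a
  proof -
    interpret L: module R "H p (trans \<Gamma> q)"
      by (rule H_module)
    obtain x where x: "x \<in> carrier (H p (trans \<Gamma> q))" "a = \<rho> x"
      using a unfolding N by blast
    have "\<rho> z \<oplus>\<^bsub>?D\<^esub> a \<in> ?N" if "z \<in> carrier (H p (trans \<Gamma> q))" for z
      unfolding x(2) \<rho>_add[OF that x(1)] N by (rule imageI) (rule free_module_closed(1)[OF that x(1)])
    moreover have "\<exists>h\<in>?N. \<rho> z = h \<oplus>\<^bsub>?D\<^esub> a" if z: "z \<in> carrier (H p (trans \<Gamma> q))" for z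
    proof (rule bexI)
      let ?d = "z \<ominus>\<^bsub>H p (trans \<Gamma> q)\<^esub> x"
      have d: "?d \<in> carrier (H p (trans \<Gamma> q))"
        using z x by simp
      have "?d \<oplus>\<^bsub>H p (trans \<Gamma> q)\<^esub> x = z"
        using z x(1) by (simp only: L.minus_eq L.a_assoc L.a_inv_closed L.l_neg L.r_zero)
      then show "\<rho> z = \<rho> ?d \<oplus>\<^bsub>?D\<^esub> a"
        unfolding x(2) \<rho>_add[OF d x(1)] by simp
      show "\<rho> ?d \<in> ?N"
        unfolding N using d by blast
    qed
    ultimately show ?thesis
      unfolding N by auto
  qed
  \<comment> \<open>With an empty kernel there would be no coset at all, so the carrier would be
    empty instead of the singleton of N.\<close>
  have "?K \<noteq> {}"
  proof -
    interpret M: unit_module R "H p q"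
      by (rule H_unit_module)
    interpret Q: abelian_monoid "?Q q"
      by (rule M.quot_module_abelian_monoid[OF I_submodule[OF p q]])
    let ?z = "\<lambda>b\<in>?A. cls p (?t b) (\<lambda>w. \<zero>)"
    have "arrow_map R \<Gamma> ?F b (?z b) = \<zero>\<^bsub>?Q q\<^esub>" if b: "b \<in> ?A" for b
      using arrow_map_cls[OF p bA(1)[OF b] free_module_zero] b bA(2)[OF b] M.quot_module_zero[OF I_submodule[OF p q]]
      by simp
    then have "?g ?z = \<zero>\<^bsub>?Q q\<^esub>"
      unfolding FOb by (subst Q.finsum_cong'[where g = "\<lambda>b. \<zero>\<^bsub>?Q q\<^esub>"]) auto
    moreover have "?z \<in> carrier ?D"
      using free_module_zero unit_module.quot_module_carrier[OF H_unit_module] by (auto simp: fin_direct_sum_def FOb)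
    ultimately have "?z \<in> ?K"
      unfolding a_kernel_def kernel_def FOb by simp
    then show ?thesis
      by blast
  qed
  then show ?thesis
    using K_sub shift
    unfolding zero_module_def mesh_homology_def homology_def
    by (auto simp: quot_module_def A_RCOSETS_def' a_r_coset_def' subset_iff)
qed

end

subsection \<open>Paths in the double quiver of type A\<close>

primrec stars :: "'e double_arrow list \<Rightarrow> nat" where
  "stars [] = 0"
| "stars (b # w) = (case b of Arr _ \<Rightarrow> 0 | Star _ \<Rightarrow> 1) + stars w"

primrec arrs :: "'e double_arrow list \<Rightarrow> nat" where
  "arrs [] = 0"
| "arrs (b # w) = (case b of Arr _ \<Rightarrow> 1 | Star _ \<Rightarrow> 0) + arrs w"

text \<open>
  Moving a \<open>Star\<close> in front of an \<open>Arr\<close> costs a sign modulo the mesh relations, so the number of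
  pairs of an \<open>Arr\<close> followed, anywhere later, by a \<open>Star\<close> determines the sign of a path.
\<close>

primrec inversions :: "'e double_arrow list \<Rightarrow> nat" where
  "inversions [] = 0"
| "inversions (b # w) = (case b of Arr _ \<Rightarrow> stars w | Star _ \<Rightarrow> 0) + inversions w"

lemma stars_append [simp]: "stars (u @ v) = stars u + stars v"
  by (induction u) auto

lemma arrs_append [simp]: "arrs (u @ v) = arrs u + arrs v"
  by (induction u) auto

lemma inversions_append: "inversions (u @ v) = inversions u + inversions v + arrs u * stars v"
  by (induction u) (auto split: double_arrow.split)

lemma length_eq_arrs_stars: "length w = arrs w + stars w"
  by (induction w) (auto split: double_arrow.split)

lemma stars_map [simp]: "stars (map Star xs) = length xs" "stars (map Arr xs) = 0"
  by (induction xs) auto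

abbreviation \<Gamma>A :: "nat \<Rightarrow> (nat, nat double_arrow) translation_quiver" where
  "\<Gamma>A n \<equiv> double_quiver (A_quiver n)"

lemma verts_A [simp]: "q \<in> verts (quiver (\<Gamma>A n)) \<longleftrightarrow> 1 \<le> q \<and> q \<le> n"
  by (auto simp: double_quiver_def A_quiver_def)

lemma arcs_A [simp]:
  "Arr a \<in> arcs (quiver (\<Gamma>A n)) \<longleftrightarrow> 1 \<le> a \<and> a < n"
  "Star a \<in> arcs (quiver (\<Gamma>A n)) \<longleftrightarrow> 1 \<le> a \<and> a < n"
  by (auto simp: double_quiver_def A_quiver_def)

lemma ends_A [simp]:
  "tail (quiver (\<Gamma>A n)) (Arr a) = a" "head (quiver (\<Gamma>A n)) (Arr a) = Suc a"
  "tail (quiver (\<Gamma>A n)) (Star a) = Suc a" "head (quiver (\<Gamma>A n)) (Star a) = a"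
  by (auto simp: double_quiver_def A_quiver_def)

lemma trans_A [simp]:
  "trans (\<Gamma>A n) q = q" "semitrans (\<Gamma>A n) (Arr a) = Star a" "semitrans (\<Gamma>A n) (Star a) = Arr a"
  by (auto simp: double_quiver_def)

lemma finite_arcs_A: "finite (arcs (quiver (\<Gamma>A n)))"
  by (simp add: double_quiver_def A_quiver_def)

lemma in_arcs_A:
  assumes "1 \<le> q" "q \<le> n"
  shows "in_arcs (quiver (\<Gamma>A n)) q
    = (if 1 < q then {Arr (q - 1)} else {}) \<union> (if q < n then {Star q} else {})"
proof (rule Set.set_eqI)
  fix b
  show "b \<in> in_arcs (quiver (\<Gamma>A n)) q
    \<longleftrightarrow> b \<in> (if 1 < q then {Arr (q - 1)} else {}) \<union> (if q < n then {Star q} else {})"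
    using assms by (cases b) (auto split: if_splits)
qed

abbreviation "P n \<equiv> paths (quiver (\<Gamma>A n))"

lemma paths_A_simps [simp]:
  "[] \<in> P n p q \<longleftrightarrow> p = q \<and> 1 \<le> p \<and> p \<le> n"
  "Arr a # w \<in> P n p q \<longleftrightarrow> 1 \<le> a \<and> a < n \<and> p = a \<and> w \<in> P n (Suc a) q"
  "Star a # w \<in> P n p q \<longleftrightarrow> 1 \<le> a \<and> a < n \<and> p = Suc a \<and> w \<in> P n a q"
  by (auto simp: paths_def pre_digraph.awalk_def pre_digraph.cas.simps)

lemma paths_A_append_iff: "u @ v \<in> P n p r \<longleftrightarrow> (\<exists>q. u \<in> P n p q \<and> v \<in> P n q r)"
proof (induction u arbitrary: p)
  case Nil
  have "v \<in> P n p r \<Longrightarrow> 1 \<le> p \<and> p \<le> n"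
    by (auto simp: paths_def pre_digraph.awalk_def)
  then show ?case
    by auto
next
  case (Cons b u)
  then show ?case
    by (cases b) auto
qed

text \<open>An \<open>Arr\<close> raises the current vertex by one and a \<open>Star\<close> lowers
  it by one.\<close>

lemma paths_A_balance:
  assumes "w \<in> P n p q"
  shows "p + arrs w = q + stars w" "1 \<le> p" "p \<le> n" "1 \<le> q" "q \<le> n"
proof -
  have "p + arrs w = q + stars w \<and> 1 \<le> p \<and> p \<le> n \<and> 1 \<le> q \<and> q \<le> n"
    using assms
  proof (induction w arbitrary: p)
    case (Cons b w)
    then show ?case
      by (cases b) fastforce+
  qed auto
  then show "p + arrs w = q + stars w" "1 \<le> p" "p \<le> n" "1 \<le> q" "q \<le> n"
    by blast+
qed

definition Pm :: "nat \<Rightarrow> nat \<Rightarrow> nat \<Rightarrow> nat \<Rightarrow> nat double_arrow list set" where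
  "Pm n p q m = {w \<in> P n p q. stars w = m}"

lemma Pm_empty: "q + m < p \<Longrightarrow> Pm n p q m = {}"
  using paths_A_balance(1) by (fastforce simp: Pm_def)

lemma arrs_Pm: "u \<in> Pm n p q m \<Longrightarrow> arrs u = q + m - p"
  using paths_A_balance(1) by (fastforce simp: Pm_def)

text \<open>The ends and the number of stars fix the length. So the sums in \<open>coord\<close> are
  finite, although there may be infinitely many paths from p to q; over an infinite set
  \<open>finsum\<close> would default to zero.\<close>

lemma finite_Pm: "finite (Pm n p q m)"
proof (rule finite_subset)
  have "set w \<subseteq> arcs (quiver (\<Gamma>A n)) \<and> length w = q + m - p + m" if "w \<in> Pm n p q m" for w
    using arrs_Pm[OF that] that
    by (auto simp: Pm_def paths_def pre_digraph.awalk_def length_eq_arrs_stars)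
  then show "Pm n p q m \<subseteq> {w. set w \<subseteq> arcs (quiver (\<Gamma>A n)) \<and> length w = q + m - p + m}"
    by blast
  show "finite {w. set w \<subseteq> arcs (quiver (\<Gamma>A n)) \<and> length w = q + m - p + m}"
    by (rule finite_lists_length_eq[OF finite_arcs_A])
qed

text \<open>The normal form goes down from \<open>p\<close> by \<open>j\<close> steps and then up to \<open>q\<close>; truncated subtraction makes
  it meaningful only for \<open>j < p \<le> q + j\<close>.\<close>

definition nf :: "nat \<Rightarrow> nat \<Rightarrow> nat \<Rightarrow> nat double_arrow list" where
  "nf p q j = map Star (rev [p - j..<p]) @ map Arr [p - j..<q]"

lemma stars_nf: "j \<le> p \<Longrightarrow> stars (nf p q j) = j"
  by (simp add: nf_def)

lemma inversions_nf: "inversions (nf p q j) = 0"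
proof -
  have "inversions (map Star xs) = 0" "inversions (map Arr xs) = 0" for xs :: "nat list"
    by (induction xs) auto
  then show ?thesis
    by (simp add: nf_def inversions_append)
qed

lemma map_Arr_path: "1 \<le> s \<Longrightarrow> s \<le> q \<Longrightarrow> q \<le> n \<Longrightarrow> map Arr [s..<q] \<in> P n s q"
proof (induction q)
  case (Suc q)
  then show ?case
    by (cases "s = Suc q") (auto simp: paths_A_append_iff)
qed simp

lemma map_Star_path: "1 \<le> s \<Longrightarrow> s \<le> p \<Longrightarrow> p \<le> n \<Longrightarrow> map Star (rev [s..<p]) \<in> P n p s"
proof (induction p)
  case (Suc p)
  then show ?case
    by (cases "s = Suc p") auto
qed simp

lemma nf_path:
  assumes "j < p" "p \<le> n" "p \<le> q + j" "q \<le> n"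
  shows "nf p q j \<in> P n p q"
  unfolding nf_def paths_A_append_iff
  by (rule exI[where x = "p - j"]) (use assms in \<open>auto intro!: map_Arr_path map_Star_path\<close>)

text \<open>Normal forms survive an appended \<open>Arr\<close> unchanged, so only an appended
  \<open>Star\<close> calls for rewriting.\<close>

lemma nf_Arr: "p \<le> q + j \<Longrightarrow> nf p q j @ [Arr q] = nf p (Suc q) j"
  by (simp add: nf_def)

section \<open>Signed coordinates and their behaviour under composition\<close>

locale type_A = cring R for R :: "('k, 'r) ring_scheme" (structure) + fixes n :: nat
begin

sublocale mesh_quiver R "\<Gamma>A n"
  by (intro mesh_quiver.intro is_cring stable_translation_quiver_double fin_digraph_A_quiver)

definition sign :: "nat \<Rightarrow> 'k" where
  "sign m = (if even m then \<one> else \<ominus> \<one>)"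

lemma sign_closed [simp]: "sign m \<in> carrier R"
  by (simp add: sign_def)

lemma sign_0 [simp]: "sign 0 = \<one>"
  by (simp add: sign_def)

lemma sign_Suc: "sign (Suc m) = \<ominus> sign m"
  by (simp add: sign_def)

lemma sign_add: "sign (a + b) = sign a \<otimes> sign b"
  by (simp add: sign_def l_minus)

lemma sign_square: "sign a \<otimes> sign a = \<one>"
  by (simp add: sign_def l_minus)

text \<open>
  Up to sign, the paths \<open>p \<rightarrow> q\<close> with \<open>m\<close> downward arrows all agree in the mesh category;
  \<open>coord p q m\<close> is the coefficient of their common class. This class vanishes unless \<open>m < p\<close> and
  \<open>q + m \<le> n\<close>.
\<close>

definition coord :: "nat \<Rightarrow> nat \<Rightarrow> nat \<Rightarrow> (nat double_arrow list \<Rightarrow> 'k) \<Rightarrow> 'k" where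
  "coord p q m f = (\<Oplus>w\<in>Pm n p q m. sign (inversions w) \<otimes> f w)"

lemma coord_closed [simp]: "(\<And>x. f x \<in> carrier R) \<Longrightarrow> coord p q m f \<in> carrier R"
  unfolding coord_def by (rule finsum_closed) auto

lemma coord_empty: "q + m < p \<Longrightarrow> coord p q m f = \<zero>"
  by (simp add: coord_def Pm_empty)

lemma coord_zero [simp]: "coord p q m (\<lambda>x. \<zero>) = \<zero>"
  by (simp add: coord_def)

lemma coord_add:
  assumes "\<And>x. f x \<in> carrier R" "\<And>x. g x \<in> carrier R"
  shows "coord p q m (\<lambda>x. f x \<oplus> g x) = coord p q m f \<oplus> coord p q m g"
  unfolding coord_def by (subst finsum_addf[symmetric]) (auto simp: assms r_distr)

lemma coord_smult:
  assumes "c \<in> carrier R" "\<And>x. f x \<in> carrier R"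
  shows "coord p q m (\<lambda>x. c \<otimes> f x) = c \<otimes> coord p q m f"
  unfolding coord_def by (subst finsum_rdistr) (auto simp: assms m_lcomm finite_Pm)

lemma coord_minus:
  assumes "\<And>x. f x \<in> carrier R" "\<And>x. g x \<in> carrier R"
  shows "coord p q m (\<lambda>x. f x \<ominus> g x) = coord p q m f \<ominus> coord p q m g"
proof -
  have "coord p q m (\<lambda>x. f x \<ominus> g x) = coord p q m (\<lambda>x. f x \<oplus> (\<ominus> \<one>) \<otimes> g x)"
    using assms by (simp add: a_minus_def l_minus)
  also have "\<dots> = coord p q m f \<oplus> (\<ominus> \<one>) \<otimes> coord p q m g"
    using assms by (simp add: coord_add coord_smult)
  finally show ?thesis
    using assms by (simp add: a_minus_def l_minus)
qed

lemma coord_single: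
  assumes "w \<in> Pm n p q m" "\<And>x. f x \<in> carrier R" "\<And>x. x \<in> Pm n p q m \<Longrightarrow> x \<noteq> w \<Longrightarrow> f x = \<zero>"
  shows "coord p q m f = sign (inversions w) \<otimes> f w"
proof -
  have "coord p q m f = (\<Oplus>x\<in>{w}. sign (inversions x) \<otimes> f x)"
    unfolding coord_def
    by (rule add.finprod_mono_neutral_cong_right) (use assms finite_Pm in auto)
  then show ?thesis
    using assms(2) by simp
qed

lemma coord_gen:
  assumes "w \<in> P n p q"
  shows "coord p q m (free_gen R w) = (if stars w = m then sign (inversions w) else \<zero>)"
proof (cases "stars w = m")
  case True
  then show ?thesis
    using assms by (subst coord_single[where w = w]) (auto simp: Pm_def free_gen_def)
next
  case False
  then have "coord p q m (free_gen R w) = (\<Oplus>x\<in>Pm n p q m. \<zero>)"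
    unfolding coord_def by (intro finsum_cong') (auto simp: Pm_def free_gen_def)
  then show ?thesis
    using False by simp
qed

text \<open>The paths that contribute are u @ v with u from p to q. The pairs formed by an
  \<open>Arr\<close> of u and a \<open>Star\<close> of v number \<open>arrs u * stars v\<close>, and
  \<open>arrs u\<close> is the same for all these u; hence one common sign factors out of the
  sum.\<close>

lemma coord_conv_left:
  assumes v: "v \<in> P n q r" and f: "f \<in> carrier (H p q)"
  shows "coord p r m (conv (free_gen R v) f) =
    (if stars v \<le> m
     then sign (inversions v + (q + (m - stars v) - p) * stars v) \<otimes> coord p q (m - stars v) f else \<zero>)"
proof -
  note fD = free_module_carrierD[OF f]
  let ?F = "\<lambda>w. sign (inversions w) \<otimes> conv (free_gen R v) f w"
  \<comment> \<open>The case split guards against truncated subtraction, which for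
    \<open>stars v > m\<close> would let in the paths without stars.\<close>
  let ?S = "if stars v \<le> m then Pm n p q (m - stars v) else {}"
  let ?c = "sign (inversions v + (q + (m - stars v) - p) * stars v)"
  have F: "?F w \<in> carrier R" for w
    using fD(1) by (simp add: conv_closed)
  have sub: "(\<lambda>u. u @ v) ` ?S \<subseteq> Pm n p r m"
    using v paths_append by (auto simp: Pm_def)
  have zero: "?F w = \<zero>" if w: "w \<in> Pm n p r m - (\<lambda>u. u @ v) ` ?S" for w
  proof (cases "\<exists>u. w = u @ v")
    case True
    then obtain u where u: "w = u @ v"
      by blast
    have "u \<notin> P n p q"
    proof
      assume "u \<in> P n p q"
      then have "u \<in> ?S"
        using w u by (auto simp: Pm_def)
      then show False
        using w u by blast
    qed
    then show ?thesis
      using fD u by (simp add: conv_gen_left)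
  next
    case False
    then show ?thesis
      using fD by (simp add: conv_gen_left_zero)
  qed
  have summand: "?F (u @ v) = ?c \<otimes> (sign (inversions u) \<otimes> f u)" if "u \<in> ?S" for u
    using that fD(1) arrs_Pm[of u n p q "m - stars v"]
    by (auto simp: conv_gen_left inversions_append sign_add m_ac split: if_splits)
  have "coord p r m (conv (free_gen R v) f) = (\<Oplus>w\<in>(\<lambda>u. u @ v) ` ?S. ?F w)"
    unfolding coord_def by (rule add.finprod_mono_neutral_cong_right) (use finite_Pm sub zero F in auto)
  also have "\<dots> = (\<Oplus>u\<in>?S. ?F (u @ v))"
    by (rule finsum_reindex) (use F in \<open>auto simp: inj_on_def\<close>)
  also have "\<dots> = (\<Oplus>u\<in>?S. ?c \<otimes> (sign (inversions u) \<otimes> f u))"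
    by (rule finsum_cong') (use summand fD(1) in auto)
  finally show ?thesis
    using fD(1) finite_Pm by (simp add: coord_def finsum_rdistr)
qed

text \<open>The mirror image: u is now fixed, and the varying second part always has m -
  \<open>stars u\<close> stars.\<close>

lemma coord_conv_right:
  assumes u: "u \<in> P n p q" and g: "g \<in> carrier (H q r)"
  shows "coord p r m (conv g (free_gen R u)) =
    (if stars u \<le> m
     then sign (inversions u + arrs u * (m - stars u)) \<otimes> coord q r (m - stars u) g else \<zero>)"
proof -
  note gD = free_module_carrierD[OF g]
  let ?F = "\<lambda>w. sign (inversions w) \<otimes> conv g (free_gen R u) w"
  let ?S = "if stars u \<le> m then Pm n q r (m - stars u) else {}"
  let ?c = "sign (inversions u + arrs u * (m - stars u))"
  have F: "?F w \<in> carrier R" for w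
    using gD(1) by (simp add: conv_closed)
  have sub: "(\<lambda>v. u @ v) ` ?S \<subseteq> Pm n p r m"
    using u paths_append by (auto simp: Pm_def)
  have zero: "?F w = \<zero>" if w: "w \<in> Pm n p r m - (\<lambda>v. u @ v) ` ?S" for w
  proof (cases "\<exists>v. w = u @ v")
    case True
    then obtain v where v: "w = u @ v"
      by blast
    have "v \<notin> P n q r"
    proof
      assume "v \<in> P n q r"
      then have "v \<in> ?S"
        using w v by (auto simp: Pm_def)
      then show False
        using w v by blast
    qed
    then show ?thesis
      using gD v by (simp add: conv_gen_right)
  next
    case False
    then show ?thesis
      using gD by (simp add: conv_gen_right_zero)
  qed
  have summand: "?F (u @ v) = ?c \<otimes> (sign (inversions v) \<otimes> g v)" if "v \<in> ?S" for v
    using that gD(1)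
    by (auto simp: conv_gen_right inversions_append sign_add m_ac Pm_def split: if_splits)
  have "coord p r m (conv g (free_gen R u)) = (\<Oplus>w\<in>(\<lambda>v. u @ v) ` ?S. ?F w)"
    unfolding coord_def by (rule add.finprod_mono_neutral_cong_right) (use finite_Pm sub zero F in auto)
  also have "\<dots> = (\<Oplus>v\<in>?S. ?F (u @ v))"
    by (rule finsum_reindex) (use F in \<open>auto simp: inj_on_def\<close>)
  also have "\<dots> = (\<Oplus>v\<in>?S. ?c \<otimes> (sign (inversions v) \<otimes> g v))"
    by (rule finsum_cong') (use summand gD(1) in auto)
  finally show ?thesis
    using gD(1) finite_Pm by (simp add: coord_def finsum_rdistr)
qed

text \<open>The arrow missing at an end vertex becomes a zero summand, so that end vertices and
  inner vertices are treated alike.\<close>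

lemma finsum_in_arcs:
  assumes "abelian_monoid M" "1 \<le> q" "q \<le> n"
    and "1 < q \<Longrightarrow> F (Arr (q - 1)) \<in> carrier M" "q < n \<Longrightarrow> F (Star q) \<in> carrier M"
  shows "(\<Oplus>\<^bsub>M\<^esub>b\<in>in_arcs (quiver (\<Gamma>A n)) q. F b) =
    (if 1 < q then F (Arr (q - 1)) else \<zero>\<^bsub>M\<^esub>) \<oplus>\<^bsub>M\<^esub> (if q < n then F (Star q) else \<zero>\<^bsub>M\<^esub>)"
proof -
  interpret M: abelian_monoid M
    by fact
  show ?thesis
    using assms(2-) by (cases "1 < q"; cases "q < n") (auto simp: in_arcs_A M.finsum_insert M.a_comm)
qed

lemma mesh_rel_eq:
  assumes "1 \<le> q" "q \<le> n"
  shows "mesh_rel R (\<Gamma>A n) q = (\<lambda>x. (if 1 < q then free_gen R [Star (q - 1), Arr (q - 1)] x else \<zero>)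
    \<oplus> (if q < n then free_gen R [Arr q, Star q] x else \<zero>))"
proof -
  interpret M: module R "H q q"
    by (rule H_module)
  have "mesh_rel R (\<Gamma>A n) q = (if 1 < q then free_gen R [Star (q - 1), Arr (q - 1)] else \<zero>\<^bsub>H q q\<^esub>)
    \<oplus>\<^bsub>H q q\<^esub> (if q < n then free_gen R [Arr q, Star q] else \<zero>\<^bsub>H q q\<^esub>)"
    unfolding mesh_rel_def
    by (subst finsum_in_arcs) (use assms M.abelian_monoid_axioms in \<open>auto intro!: free_gen_carrier\<close>)
  then show ?thesis
    by (auto simp: fun_eq_iff)
qed

end


subsection \<open>The mesh ideal\<close>

context type_A
begin

definition J :: "nat \<Rightarrow> nat \<Rightarrow> (nat double_arrow list \<Rightarrow> 'k) set" where
  "J p q = {f \<in> carrier (H p q). \<forall>m<p. q + m \<le> n \<longrightarrow> coord p q m f = \<zero>}"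

lemma J_submodule: "submodule (J p q) R (H p q)"
proof (rule free_module_submoduleI)
  show "J p q \<subseteq> carrier (H p q)" "(\<lambda>x. \<zero>) \<in> J p q"
    by (auto simp: J_def free_module_zero)
  show "(\<lambda>x. f x \<oplus> g x) \<in> J p q" if "f \<in> J p q" "g \<in> J p q" for f g
    using that free_module_closed(1) by (auto simp: J_def coord_add free_module_carrierD(1))
  show "(\<lambda>x. c \<otimes> f x) \<in> J p q" if "c \<in> carrier R" "f \<in> J p q" for c f
    using that free_module_closed(2) by (auto simp: J_def coord_smult free_module_carrierD(1))
qed

lemma J_closed:
  shows "(\<lambda>x. \<zero>) \<in> J p q"
    and "f \<in> J p q \<Longrightarrow> g \<in> J p q \<Longrightarrow> (\<lambda>x. f x \<oplus> g x) \<in> J p q"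
    and "c \<in> carrier R \<Longrightarrow> f \<in> J p q \<Longrightarrow> (\<lambda>x. c \<otimes> f x) \<in> J p q"
  using module.submoduleE[OF H_module J_submodule]
    subgroup.one_closed[OF submodule.axioms(1)[OF J_submodule]] by auto

lemma J_conv_left:
  assumes g: "g \<in> carrier (H q r)" and f: "f \<in> J p q"
  shows "conv g f \<in> J p r"
proof -
  have fH: "f \<in> carrier (H p q)"
    using f by (simp add: J_def)
  note fD = free_module_carrierD[OF fH]
  show ?thesis
    using g
  proof (induction g rule: free_module_induct)
    case zero
    then show ?case
      using fD J_closed(1) by simp
  next
    case (add g h)
    then show ?case
      using fD J_closed(2) by (simp add: conv_add_left free_module_carrierD(1))
  next
    case (smult c g)
    then show ?case
      using fD J_closed(3) by (simp add: conv_smult_left free_module_carrierD(1))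
  next
    case (gen v)
    have "coord p r m (conv (free_gen R v) f) = \<zero>" if m: "m < p" "r + m \<le> n" for m
    proof (cases "stars v \<le> m")
      case True
      \<comment> \<open>The coordinate is in range: by the balance q + (m - \<open>stars v\<close>)
        = r + m - \<open>arrs v\<close> \<le> n.\<close>
      have "coord p q (m - stars v) f = \<zero>"
        using f m True paths_A_balance(1)[OF gen] by (auto simp: J_def)
      then show ?thesis
        by (simp add: coord_conv_left[OF gen fH])
    qed (simp add: coord_conv_left[OF gen fH])
    then show ?case
      using conv_H[OF free_gen_carrier[OF gen] fH] by (auto simp: J_def)
  qed
qed

lemma J_conv_right:
  assumes f: "f \<in> carrier (H p q)" and g: "g \<in> J q r"
  shows "conv g f \<in> J p r"
proof -
  have gH: "g \<in> carrier (H q r)"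
    using g by (simp add: J_def)
  note gD = free_module_carrierD[OF gH]
  show ?thesis
    using f
  proof (induction f rule: free_module_induct)
    case zero
    then show ?case
      using gD J_closed(1) by simp
  next
    case (add f h)
    then show ?case
      using gD J_closed(2) by (simp add: conv_add_right free_module_carrierD(1))
  next
    case (smult c f)
    then show ?case
      using gD J_closed(3) by (simp add: conv_smult_right free_module_carrierD(1))
  next
    case (gen u)
    have "coord p r m (conv g (free_gen R u)) = \<zero>" if m: "m < p" "r + m \<le> n" for m
    proof (cases "stars u \<le> m")
      case True
      \<comment> \<open>Again in range: m < p gives m - \<open>stars u\<close> < p -
        \<open>stars u\<close> = q - \<open>arrs u\<close> \<le> q.\<close>
      have "coord q r (m - stars u) g = \<zero>"
        using g m True paths_A_balance(1)[OF gen] by (auto simp: J_def)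
      then show ?thesis
        by (simp add: coord_conv_right[OF gen gH])
    qed (simp add: coord_conv_right[OF gen gH])
    then show ?case
      using conv_H[OF gH free_gen_carrier[OF gen]] by (auto simp: J_def)
  qed
qed

lemma mesh_rel_in_J:
  assumes q: "1 \<le> q" "q \<le> n"
  shows "mesh_rel R (\<Gamma>A n) q \<in> J q q"
proof -
  have d: "[Star (q - 1), Arr (q - 1)] \<in> P n q q" if "1 < q"
    using that q by auto
  have u: "[Arr q, Star q] \<in> P n q q" if "q < n"
    using that q by auto
  have "mesh_rel R (\<Gamma>A n) q \<in> carrier (H q q)"
    using I_closed(1)[of q q] mesh_rel_in_I[of q] q by simp
  moreover have "coord q q m (mesh_rel R (\<Gamma>A n) q) = \<zero>" if m: "m < q" "q + m \<le> n" for m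
  \<comment> \<open>Both paths in the relation have one star, and their signs are opposite since
    only \<open>Arr\<close> before \<open>Star\<close> is an inversion. At q = 1 or q = n a single
    path remains, with nothing to cancel it, but there m = 1 is out of range.\<close>
  proof (cases "m = 1")
    case True
    then have "1 < q" "q < n"
      using m by auto
    then show ?thesis
      using True coord_gen[OF d] coord_gen[OF u] unfolding mesh_rel_eq[OF q]
      by (simp add: coord_add sign_def r_neg)
  next
    case False
    have "coord q q m (\<lambda>x. if 1 < q then free_gen R [Star (q - 1), Arr (q - 1)] x else \<zero>) = \<zero>"
      using False coord_gen[OF d] by (cases "1 < q") auto
    moreover have "coord q q m (\<lambda>x. if q < n then free_gen R [Arr q, Star q] x else \<zero>) = \<zero>"
      using False coord_gen[OF u] by (cases "q < n") auto
    ultimately show ?thesis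
      unfolding mesh_rel_eq[OF q] by (subst coord_add) auto
  qed
  ultimately show ?thesis
    by (simp add: J_def)
qed

lemma I_subset_J: "I p q \<subseteq> J p q"
proof (rule I_subset)
  show "two_sided_ideal R (path_cat R (quiver (\<Gamma>A n))) J"
    unfolding two_sided_ideal_def using J_submodule J_conv_left J_conv_right by auto
qed (use mesh_rel_in_J in auto)

section \<open>Straightening paths, and combinations of normal forms, modulo the mesh ideal\<close>

definition eqv where
  "eqv p q u c v \<longleftrightarrow> (\<lambda>x. free_gen R u x \<ominus> c \<otimes> free_gen R v x) \<in> I p q"

lemma eqv_refl: "p \<in> V \<Longrightarrow> q \<in> V \<Longrightarrow> eqv p q u \<one> u"
  using I_closed(2) by (simp add: eqv_def r_neg a_minus_def)

text \<open>The scalar zero expresses that u vanishes; the second word is then a dummy. This lets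
  sign changes and vanishing share one relation and one transitivity rule.\<close>

lemma eqv_zero: "eqv p q u \<zero> v \<Longrightarrow> eqv p q u \<zero> v'"
  by (simp add: eqv_def)

lemma eqv_trans:
  assumes "p \<in> V" "q \<in> V" "c \<in> carrier R" "d \<in> carrier R" "eqv p q u c v" "eqv p q v d w"
  shows "eqv p q u (c \<otimes> d) w"
proof -
  have "(\<lambda>x. (free_gen R u x \<ominus> c \<otimes> free_gen R v x) \<oplus> c \<otimes> (free_gen R v x \<ominus> d \<otimes> free_gen R w x)) \<in> I p q"
    using I_closed(3)[OF assms(1,2)] I_closed(4)[OF assms(1,2)] assms unfolding eqv_def by simp
  moreover have "(x \<ominus> c \<otimes> y) \<oplus> c \<otimes> (y \<ominus> d \<otimes> z) = x \<ominus> (c \<otimes> d) \<otimes> z"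
    if "x \<in> carrier R" "y \<in> carrier R" "z \<in> carrier R" for x y z
    using that assms(3,4) by algebra
  ultimately show ?thesis
    by (simp add: eqv_def)
qed

text \<open>A sign is its own inverse, so multiplying by its negative exchanges the two
  sides.\<close>

lemma eqv_sym:
  assumes "p \<in> V" "q \<in> V" "eqv p q u (sign m) v"
  shows "eqv p q v (sign m) u"
proof -
  have "(\<lambda>x. (\<ominus> sign m) \<otimes> (free_gen R u x \<ominus> sign m \<otimes> free_gen R v x)) \<in> I p q"
    using I_closed(4)[OF assms(1,2) _ assms(3)[unfolded eqv_def]] by simp
  moreover have "(\<ominus> sign m) \<otimes> (x \<ominus> sign m \<otimes> y) = y \<ominus> sign m \<otimes> x"
    if "x \<in> carrier R" "y \<in> carrier R" for x y
  proof -
    have "(\<ominus> sign m) \<otimes> (x \<ominus> sign m \<otimes> y) = (sign m \<otimes> sign m) \<otimes> y \<ominus> sign m \<otimes> x"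
      using that sign_closed[of m] by algebra
    then show ?thesis
      using that by (simp add: sign_square)
  qed
  ultimately show ?thesis
    by (simp add: eqv_def)
qed

lemma eqv_append:
  assumes "c \<in> carrier R" "p \<in> V" "q \<in> V" "eqv p q u c v" "w \<in> P n q r"
  shows "eqv p r (u @ w) c (v @ w)"
proof -
  have "conv (free_gen R w) (\<lambda>x. free_gen R u x \<oplus> (\<ominus> c) \<otimes> free_gen R v x) \<in> I p r"
    using assms paths_A_balance[OF assms(5)] unfolding eqv_def
    by (intro I_conv_left[where q = q]) (auto intro: free_gen_carrier simp: a_minus_def l_minus)
  also have "conv (free_gen R w) (\<lambda>x. free_gen R u x \<oplus> (\<ominus> c) \<otimes> free_gen R v x)
      = (\<lambda>x. free_gen R (u @ w) x \<oplus> (\<ominus> c) \<otimes> free_gen R (v @ w) x)"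
    using assms(1) by (simp add: conv_add_right conv_smult_right conv_gen_gen)
  finally show ?thesis
    using assms(1) by (simp add: eqv_def a_minus_def l_minus)
qed

lemma eqv_prepend:
  assumes "c \<in> carrier R" "q \<in> V" "r \<in> V" "eqv q r u c v" "w \<in> P n p q"
  shows "eqv p r (w @ u) c (w @ v)"
proof -
  have "conv (\<lambda>x. free_gen R u x \<oplus> (\<ominus> c) \<otimes> free_gen R v x) (free_gen R w) \<in> I p r"
    using assms paths_A_balance[OF assms(5)] unfolding eqv_def
    by (intro I_conv_right[where q = q]) (auto intro: free_gen_carrier simp: a_minus_def l_minus)
  also have "conv (\<lambda>x. free_gen R u x \<oplus> (\<ominus> c) \<otimes> free_gen R v x) (free_gen R w)
      = (\<lambda>x. free_gen R (w @ u) x \<oplus> (\<ominus> c) \<otimes> free_gen R (w @ v) x)"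
    using assms(1) by (simp add: conv_add_left conv_smult_left conv_gen_gen)
  finally show ?thesis
    using assms(1) by (simp add: eqv_def a_minus_def l_minus)
qed

text \<open>For q = 1 the right-hand word would use an arrow numbered 0; it is a dummy
  there.\<close>

lemma eqv_mesh:
  assumes "1 \<le> q" "q < n"
  shows "eqv q q [Arr q, Star q] (if 1 < q then sign 1 else \<zero>) [Star (q - 1), Arr (q - 1)]"
  using mesh_rel_in_I[of q] assms
  by (auto simp: mesh_rel_eq eqv_def a_minus_def l_minus sign_def a_comm)

lemma eqv_mesh_last:
  assumes "2 \<le> n"
  shows "eqv n n [Star (n - 1), Arr (n - 1)] \<zero> v"
  using mesh_rel_in_I[of n] assms by (auto simp: mesh_rel_eq eqv_def a_minus_def)

text \<open>The final \<open>Star\<close> travels to the left through the Suc q - s upward arrows,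
  changing the sign at each. If the run starts at s = 1, the last exchange happens at vertex 1,
  where the relation kills the path.\<close>

lemma eqv_ups_down:
  assumes "1 \<le> s" "s \<le> q" "q < n"
  shows "eqv s q (map Arr [s..<Suc q] @ [Star q]) (if 1 < s then sign (Suc q - s) else \<zero>)
    (Star (s - 1) # map Arr [s - 1..<q])"
  using assms(2,3)
proof (induction q rule: dec_induct)
  case base
  have "[s - 1..<s] = [s - 1]"
    using assms(1) by (cases s) auto
  then show ?case
    using eqv_mesh[OF assms(1) base] assms(1) by (auto simp: sign_def split: if_splits)
next
  case (step q)
  let ?c = "if 1 < s then sign (Suc q - s) else \<zero>" and ?v = "Star (s - 1) # map Arr [s - 1..<q]"
  let ?w = "map Arr [s..<Suc q]"
  have q: "1 \<le> q" "Suc q < n" "s \<le> q"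
    using assms(1) step by auto
  have w: "?w \<in> P n s (Suc q)"
    using q assms(1) by (intro map_Arr_path) auto
  \<comment> \<open>The relation at Suc q exchanges the last two arrows; the \<open>Star\<close> is
    then one step lower, where the induction hypothesis applies.\<close>
  have "eqv (Suc q) (Suc q) [Arr (Suc q), Star (Suc q)] (sign 1) [Star q, Arr q]"
    using eqv_mesh[of "Suc q"] q by simp
  from eqv_prepend[OF _ _ _ this w]
  have 1: "eqv s (Suc q) (?w @ [Arr (Suc q), Star (Suc q)]) (sign 1) (?w @ [Star q, Arr q])"
    using q by simp
  have "eqv s q (?w @ [Star q]) ?c ?v"
    using step q by simp
  from eqv_append[OF _ _ _ this, of "[Arr q]" "Suc q"]
  have 2: "eqv s (Suc q) (?w @ [Star q, Arr q]) ?c (?v @ [Arr q])"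
    using q assms(1) by simp
  have "eqv s (Suc q) (?w @ [Arr (Suc q), Star (Suc q)]) (sign 1 \<otimes> ?c) (?v @ [Arr q])"
    by (rule eqv_trans[OF _ _ _ _ 1 2]) (use q assms(1) in auto)
  moreover have "sign 1 \<otimes> ?c = (if 1 < s then sign (Suc (Suc q) - s) else \<zero>)"
    using q by (simp add: sign_add[symmetric] Suc_diff_le)
  moreover have "?v @ [Arr q] = Star (s - 1) # map Arr [s - 1..<Suc q]"
    using q by simp
  ultimately show ?case
    using q by simp
qed

lemma eqv_nf_Star:
  assumes "j < p" "p \<le> n" "p \<le> Suc q + j" "q < n" "1 \<le> q"
  shows "eqv p q (nf p (Suc q) j @ [Star q]) (if Suc j < p then sign (Suc q + j - p) else \<zero>) (nf p q (Suc j))"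
proof (cases "p = Suc q + j")
  \<comment> \<open>Here the normal form has no upward arrows, and the new \<open>Star\<close> just
    prolongs the descent.\<close>
  case True
  then have "nf p (Suc q) j @ [Star q] = nf p q (Suc j)"
    by (simp add: nf_def upt_conv_Cons)
  then show ?thesis
    using eqv_refl[of p q] True assms by simp
next
  case False
  \<comment> \<open>The lowest vertex on the normal form.\<close>
  define s where "s = p - j"
  have s: "1 \<le> s" "s \<le> q" "s \<le> p" "p = s + j"
    using False assms by (auto simp: s_def)
  have w: "map Star (rev [s..<p]) \<in> P n p s"
    by (rule map_Star_path) (use s assms in auto)
  have "eqv p q (map Star (rev [s..<p]) @ map Arr [s..<Suc q] @ [Star q]) (if 1 < s then sign (Suc q - s) else \<zero>)
    (map Star (rev [s..<p]) @ Star (s - 1) # map Arr [s - 1..<q])"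
    by (rule eqv_prepend[OF _ _ _ eqv_ups_down w]) (use s assms in auto)
  moreover have "nf p (Suc q) j @ [Star q] = map Star (rev [s..<p]) @ map Arr [s..<Suc q] @ [Star q]"
    by (simp add: nf_def s_def)
  moreover have "nf p q (Suc j) = map Star (rev [s..<p]) @ Star (s - 1) # map Arr [s - 1..<q]" if "Suc j < p"
  proof -
    have "[s - 1..<p] = (s - 1) # [s..<p]"
      using s by (subst upt_conv_Cons) auto
    then show ?thesis
      by (simp add: nf_def s_def)
  qed
  ultimately show ?thesis
    using s eqv_zero by (auto split: if_splits)
qed

text \<open>\<open>eqv_nf_Star\<close> is read backwards: one step of the descent is moved to the
  end of the path, so that the part before it climbs one vertex higher. Repeating this leads to a
  path through n, where the relation at n applies. Only the first value beyond the range is needed,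
  since an \<open>Arr\<close> raises q by one.\<close>

lemma eqv_nf_zero:
  assumes "j < p" "p \<le> n" "p \<le> q + j" "1 \<le> q" "q \<le> n" "q + j = Suc n"
  shows "eqv p q (nf p q j) \<zero> v"
  using assms
proof (induction j arbitrary: q v)
  case 0
  then show ?case
    by simp
next
  case (Suc i)
  have pV: "p \<in> V" "q \<in> V"
    using Suc.prems by auto
  show ?case
  proof (cases "q = n")
    case False
    then have q: "Suc q \<le> n"
      using Suc.prems by simp
    have 1: "eqv p q (nf p q (Suc i)) (sign (Suc q + i - p)) (nf p (Suc q) i @ [Star q])"
      by (rule eqv_sym[OF pV]) (use eqv_nf_Star[of i p q] Suc.prems q in auto)
    have 2: "eqv p q (nf p (Suc q) i @ [Star q]) \<zero> ([] @ [Star q])"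
      by (rule eqv_append[where q = "Suc q"]) (use Suc q in auto)
    have "eqv p q (nf p q (Suc i)) (sign (Suc q + i - p) \<otimes> \<zero>) ([] @ [Star q])"
      by (rule eqv_trans[OF pV _ _ 1 2]) auto
    then show ?thesis
      using eqv_zero by simp
  next
    case True
    then have i: "i = 0" and n: "2 \<le> n"
      using Suc.prems by auto
    let ?m = "n - 1"
    have m: "Suc ?m = n" "1 \<le> ?m" "?m < n"
      using n by auto
    \<comment> \<open>The final \<open>Arr\<close> is set aside, the rest is rerouted through n, and
      putting the \<open>Arr\<close> back completes the mesh relation at n.\<close>
    have "eqv p ?m (nf p ?m 1) (sign (n - p)) (nf p n 0 @ [Star ?m])"
      by (rule eqv_sym) (use eqv_nf_Star[of 0 p ?m] Suc.prems m i True in auto)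
    from eqv_append[OF _ _ _ this, of "[Arr ?m]" n]
    have 1: "eqv p n (nf p n 1) (sign (n - p)) (nf p n 0 @ [Star ?m, Arr ?m])"
      using Suc.prems m nf_Arr[of p ?m 1] by simp
    have "nf p n 0 \<in> P n p n"
      by (rule nf_path) (use Suc.prems in auto)
    from eqv_prepend[OF _ _ _ eqv_mesh_last[OF n] this]
    have 2: "eqv p n (nf p n 0 @ [Star ?m, Arr ?m]) \<zero> (nf p n 0 @ v)"
      using n by simp
    have "eqv p n (nf p n 1) (sign (n - p) \<otimes> \<zero>) (nf p n 0 @ v)"
      by (rule eqv_trans[OF _ _ _ _ 1 2]) (use pV n in auto)
    then show ?thesis
      using True i eqv_zero by simp
  qed
qed

text \<open>Induction on the last arrow. An appended \<open>Arr\<close> can violate only q + m \<le>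
  n, and then by exactly one; an appended \<open>Star\<close> leaves q + m unchanged and can violate
  only m < p.\<close>

lemma eqv_nf:
  assumes "w \<in> P n p q"
  shows "eqv p q w (if stars w < p \<and> q + stars w \<le> n then sign (inversions w) else \<zero>) (nf p q (stars w))"
  using assms
proof (induction w arbitrary: q rule: rev_induct)
  case Nil
  then show ?case
    using eqv_refl[of p p "[]"] by (auto simp: nf_def)
next
  case (snoc b u)
  show ?case
  proof (cases b)
    case (Arr a)
    then have u: "u \<in> P n p a" and q: "q = Suc a" "1 \<le> a" "a < n"
      using snoc.prems by (auto simp: paths_A_append_iff)
    note bal = paths_A_balance[OF u]
    let ?c = "if stars u < p \<and> a + stars u \<le> n then sign (inversions u) else \<zero>"
    have "eqv p q (u @ [b]) ?c (nf p a (stars u) @ [Arr a])"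
      unfolding Arr by (rule eqv_append[OF _ _ _ snoc.IH[OF u]]) (use q bal in auto)
    then have 1: "eqv p q (u @ [b]) ?c (nf p q (stars u))"
      using nf_Arr[of p a "stars u"] bal q by simp
    show ?thesis
    proof (cases "stars u < p \<and> a + stars u = n")
      case True
      have "eqv p q (nf p q (stars u)) \<zero> (nf p q (stars u))"
        by (rule eqv_nf_zero) (use True bal q in auto)
      from eqv_trans[OF _ _ _ _ 1 this] have "eqv p q (u @ [b]) \<zero> (nf p q (stars u))"
        using q bal by simp
      then show ?thesis
        using True Arr q by simp
    next
      case False
      then have "?c = (if stars (u @ [b]) < p \<and> q + stars (u @ [b]) \<le> n then sign (inversions (u @ [b])) else \<zero>)"
        using Arr q by (auto simp: inversions_append)
      then show ?thesis
        using 1 Arr by simp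
    qed
  next
    case (Star a)
    then have u: "u \<in> P n p (Suc a)" and q: "q = a" "1 \<le> a" "a < n"
      using snoc.prems by (auto simp: paths_A_append_iff)
    note bal = paths_A_balance[OF u]
    let ?c = "if stars u < p \<and> Suc a + stars u \<le> n then sign (inversions u) else \<zero>"
    have 1: "eqv p q (u @ [b]) ?c (nf p (Suc a) (stars u) @ [Star a])"
      unfolding Star by (rule eqv_append[OF _ _ _ snoc.IH[OF u]]) (use q bal in auto)
    show ?thesis
    proof (cases "stars u < p \<and> Suc a + stars u \<le> n")
      case True
      let ?d = "if Suc (stars u) < p then sign (Suc a + stars u - p) else \<zero>"
      have 2: "eqv p q (nf p (Suc a) (stars u) @ [Star a]) ?d (nf p a (Suc (stars u)))"
        unfolding q(1) by (rule eqv_nf_Star) (use True q bal in auto)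
      have "eqv p q (u @ [b]) (?c \<otimes> ?d) (nf p a (Suc (stars u)))"
        by (rule eqv_trans[OF _ _ _ _ 1 2]) (use q bal in auto)
      \<comment> \<open>The sign exponent from moving the \<open>Star\<close> equals the number of
        inversions that it creates.\<close>
      moreover have "arrs u = Suc a + stars u - p"
        using bal by simp
      ultimately show ?thesis
        using True Star q by (auto simp: inversions_append sign_add split: if_splits)
    next
      case False
      then have "?c = \<zero>"
        by auto
      then show ?thesis
        using False 1 Star q eqv_zero by auto
    qed
  qed
qed

text \<open>The sum of \<open>c j\<close> times the normal form with j stars, over the admissible j.
  A word reveals its own j as \<open>stars x\<close>, so the sum can be written pointwise; p \<le> q
  + j excludes the j for which truncation makes \<open>nf\<close> meaningless.\<close>

definition nform :: "nat \<Rightarrow> nat \<Rightarrow> (nat \<Rightarrow> 'k) \<Rightarrow> nat double_arrow list \<Rightarrow> 'k" where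
  "nform p q c x = (if stars x < p \<and> q + stars x \<le> n \<and> p \<le> q + stars x \<and> x = nf p q (stars x) then c (stars x) else \<zero>)"

lemma nform_carrier:
  assumes "\<And>m. c m \<in> carrier R" "p \<in> V" "q \<in> V"
  shows "nform p q c \<in> carrier (H p q)"
proof (rule free_module_carrierI)
  show "nform p q c x \<in> carrier R" for x
    using assms(1) by (simp add: nform_def)
  let ?A = "nf p q ` {m. m < p \<and> p \<le> q + m}"
  show "finite ?A"
    by simp
  show "?A \<subseteq> P n p q"
    using assms by (auto intro: nf_path)
  show "nform p q c x = \<zero>" if "x \<notin> ?A" for x
    using that by (auto simp: nform_def)
qed

lemma coord_nform:
  assumes "\<And>m. c m \<in> carrier R" "p \<in> V" "q \<in> V" "m < p" "q + m \<le> n" "p \<le> q + m"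
  shows "coord p q m (nform p q c) = c m"
proof -
  have "stars (nf p q m) = m"
    by (rule stars_nf) (use assms in simp)
  moreover have "nf p q m \<in> P n p q"
    by (rule nf_path) (use assms in auto)
  ultimately show ?thesis
    using assms by (subst coord_single[where w = "nf p q m"]) (auto simp: nform_def Pm_def inversions_nf)
qed

text \<open>Both terms are linear in f, which reduces the claim to a single path; there it is
  \<open>eqv_nf\<close>.\<close>

lemma minus_nform_in_I:
  assumes "p \<in> V" "q \<in> V" "f \<in> carrier (H p q)"
  shows "(\<lambda>x. f x \<ominus> nform p q (\<lambda>m. coord p q m f) x) \<in> I p q"
  using assms(3)
proof (induction f rule: free_module_induct)
  case zero
  then show ?case
    using I_closed(2)[OF assms(1,2)] by (simp add: nform_def a_minus_def)
next
  case (add f g)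
  note D = free_module_carrierD(1)[OF add.hyps(1)] free_module_carrierD(1)[OF add.hyps(2)]
  let ?N = "\<lambda>f x. nform p q (\<lambda>m. coord p q m f) x"
  have N: "?N (\<lambda>x. f x \<oplus> g x) x = ?N f x \<oplus> ?N g x" "?N f x \<in> carrier R" "?N g x \<in> carrier R" for x
    using D by (auto simp: nform_def coord_add)
  have ring: "(a \<oplus> b) \<ominus> (c \<oplus> d) = (a \<ominus> c) \<oplus> (b \<ominus> d)"
    if "a \<in> carrier R" "b \<in> carrier R" "c \<in> carrier R" "d \<in> carrier R" for a b c d
    using that by algebra
  show ?case
    using I_closed(3)[OF assms(1,2) add.IH] D N by (simp add: ring)
next
  case (smult c f)
  note D = free_module_carrierD(1)[OF smult.hyps(2)]
  let ?N = "\<lambda>f x. nform p q (\<lambda>m. coord p q m f) x"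
  have N: "?N (\<lambda>x. c \<otimes> f x) x = c \<otimes> ?N f x" "?N f x \<in> carrier R" for x
    using D smult.hyps(1) by (auto simp: nform_def coord_smult)
  show ?case
    using I_closed(4)[OF assms(1,2) smult.hyps(1) smult.IH] D N smult.hyps(1)
    by (simp add: a_minus_def r_distr r_minus)
next
  case (gen w)
  note bal = paths_A_balance[OF gen]
  let ?c = "if stars w < p \<and> q + stars w \<le> n then sign (inversions w) else \<zero>"
  have "nform p q (\<lambda>m. coord p q m (free_gen R w)) x = ?c \<otimes> free_gen R (nf p q (stars w)) x" for x
  proof (cases "stars w < p")
    case True
    then have "stars (nf p q (stars w)) = stars w"
      by (intro stars_nf) simp
    then show ?thesis
      using bal True by (auto simp: nform_def coord_gen[OF gen] free_gen_def[of R "nf p q (stars w)"])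
  next
    case False
    then show ?thesis
      by (auto simp: nform_def coord_gen[OF gen])
  qed
  then show ?case
    using eqv_nf[OF gen] by (simp add: eqv_def)
qed

lemma J_subset_I:
  assumes "p \<in> V" "q \<in> V"
  shows "J p q \<subseteq> I p q"
proof
  fix f assume f: "f \<in> J p q"
  then have fH: "f \<in> carrier (H p q)"
    by (simp add: J_def)
  have "nform p q (\<lambda>m. coord p q m f) x = \<zero>" for x
    using f by (auto simp: nform_def J_def)
  then show "f \<in> I p q"
    using minus_nform_in_I[OF assms fH] free_module_carrierD(1)[OF fH] by (simp add: a_minus_def)
qed

text \<open>Turns equality in Q(p, q) into scalar equations, one for each admissible m.\<close>

lemma minus_in_I:
  assumes "p \<in> V" "q \<in> V" "f \<in> carrier (H p q)" "g \<in> carrier (H p q)"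
    and "\<And>m. m < p \<Longrightarrow> q + m \<le> n \<Longrightarrow> coord p q m f = coord p q m g"
  shows "(\<lambda>x. f x \<ominus> g x) \<in> I p q"
proof -
  interpret M: module R "H p q"
    by (rule H_module)
  have "f \<ominus>\<^bsub>H p q\<^esub> g \<in> carrier (H p q)"
    using assms by simp
  then have "(\<lambda>x. f x \<ominus> g x) \<in> J p q"
    using assms free_module_carrierD(1)[OF assms(3)] free_module_carrierD(1)[OF assms(4)]
    unfolding H_minus[OF assms(3,4)] by (simp add: J_def coord_minus)
  then show ?thesis
    using J_subset_I[OF assms(1,2)] by blast
qed


subsection \<open>Exactness\<close>

lemma coord_conv_Arr:
  assumes "1 \<le> q" "q < n" "f \<in> carrier (H p q)"
  shows "coord p (Suc q) m (conv (free_gen R [Arr q]) f) = coord p q m f"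
  using assms coord_conv_left[of "[Arr q]" q "Suc q" f p m] free_module_carrierD(1)[OF assms(3)] by simp

text \<open>The sign exponent counts the upward arrows that precede the new star.\<close>

lemma coord_conv_Star:
  assumes "1 \<le> q" "q < n" "f \<in> carrier (H p (Suc q))"
  shows "coord p q 0 (conv (free_gen R [Star q]) f) = \<zero>"
    and "coord p q (Suc m) (conv (free_gen R [Star q]) f) = sign (Suc q + m - p) \<otimes> coord p (Suc q) m f"
  using assms coord_conv_left[of "[Star q]" "Suc q" q f p] by simp_all

lemma zero_mesh_homology:
  assumes p: "p \<in> V" and q: "q \<in> V"
  shows "zero_module (mesh_homology R (\<Gamma>A n) (hom_functor (mesh_cat R (\<Gamma>A n)) p) q)"
proof (rule zero_mesh_homologyI[OF p q])
  let ?A = "in_arcs (quiver (\<Gamma>A n)) q" and ?t = "tail (quiver (\<Gamma>A n))"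
  fix y
  assume y: "\<And>b. b \<in> ?A \<Longrightarrow> y b \<in> carrier (H p (?t b))"
    and sum: "(\<Oplus>\<^bsub>H p q\<^esub>b\<in>?A. conv (free_gen R [b]) (y b)) \<in> I p q"
  interpret M: module R "H p q"
    by (rule H_module)
  have q': "1 \<le> q" "q \<le> n"
    using q by auto
  define r where "r = q - 1"
  have r: "q = Suc r" "1 \<le> r" "r < n" if "1 < q"
    using that q' by (auto simp: r_def)
  have yd: "y (Arr r) \<in> carrier (H p r)" if "1 < q"
    using y[of "Arr r"] r[OF that] by simp
  have yu: "y (Star q) \<in> carrier (H p (Suc q))" if "q < n"
    using y[of "Star q"] that q' by auto
  \<comment> \<open>\<open>D\<close> and \<open>U\<close> are the coordinates of the components at q
    - 1 and q + 1. The default zero stands for a component that is absent at an end vertex.\<close>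
  define D where "D m = (if 1 < q then coord p r m (y (Arr r)) else \<zero>)" for m
  define U where "U m = (if q < n then coord p (Suc q) m (y (Star q)) else \<zero>)" for m
  have DU [simp]: "D m \<in> carrier R" "U m \<in> carrier R" for m
    using free_module_carrierD(1)[OF yd] free_module_carrierD(1)[OF yu] by (auto simp: D_def U_def)
  let ?Fd = "\<lambda>x. if 1 < q then conv (free_gen R [Arr r]) (y (Arr r)) x else \<zero>"
  let ?Fu = "\<lambda>x. if q < n then conv (free_gen R [Star q]) (y (Star q)) x else \<zero>"
  have dH: "conv (free_gen R [Arr r]) (y (Arr r)) \<in> carrier (H p q)" if "1 < q"
    using r[OF that] by (intro conv_H[OF _ yd[OF that]] free_gen_carrier) auto
  have uH: "conv (free_gen R [Star q]) (y (Star q)) \<in> carrier (H p q)" if "q < n"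
    using q' that by (intro conv_H[OF _ yu[OF that]] free_gen_carrier) auto
  have "(\<Oplus>\<^bsub>H p q\<^esub>b\<in>?A. conv (free_gen R [b]) (y b)) = (\<lambda>x. ?Fd x \<oplus> ?Fu x)"
    by (subst finsum_in_arcs) (use q' dH uH M.abelian_monoid_axioms in \<open>auto simp: r_def fun_eq_iff\<close>)
  then have F: "(\<lambda>x. ?Fd x \<oplus> ?Fu x) \<in> J p q"
    using sum I_subset_J by auto
  have "?Fd x \<in> carrier R" "?Fu x \<in> carrier R" for x
    using free_module_carrierD(1)[OF dH] free_module_carrierD(1)[OF uH] by auto
  then have coord_F: "coord p q m ?Fd \<oplus> coord p q m ?Fu = \<zero>" if "m < p" "q + m \<le> n" for m
    using F that by (simp add: J_def coord_add)
  have coord_Fd: "coord p q m ?Fd = D m" for m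
    using coord_conv_Arr[OF r(2,3) yd, of m] r(1) by (cases "1 < q") (auto simp: D_def)
  have coord_Fu: "coord p q 0 ?Fu = \<zero>" "coord p q (Suc m) ?Fu = sign (Suc q + m - p) \<otimes> U m" for m
    using coord_conv_Star[OF q'(1) _ yu] by (cases "q < n"; auto simp: U_def)+
  \<comment> \<open>The coordinate 0 is always in range, and a path ending in a \<open>Star\<close>
    does not contribute to it.\<close>
  have D0: "D 0 = \<zero>"
    using coord_F[of 0] coord_Fd[of 0] coord_Fu(1) p q' by simp
  have DU_rel: "D (Suc m) \<oplus> sign (Suc q + m - p) \<otimes> U m = \<zero>" if "Suc m < p" "q + Suc m \<le> n" for m
    using coord_F[OF that] unfolding coord_Fd coord_Fu(2) .
  \<comment> \<open>The coordinates of the preimage are forced: those read off from the component at \<open>q + 1\<close>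
    cover everything except \<open>q + m = n\<close>, where the component at \<open>q - 1\<close> is used.\<close>
  define c where "c m = (if q + m < n then U m else sign (q + m - p) \<otimes> D (Suc m))" for m
  have c [simp]: "c m \<in> carrier R" for m
    by (simp add: c_def)
  let ?x = "nform p q c"
  have xH: "?x \<in> carrier (H p q)"
    by (rule nform_carrier) (use p q in auto)
  have up: "(\<lambda>w. y (Star q) w \<ominus> conv (free_gen R [Arr q]) ?x w) \<in> I p (Suc q)" if qn: "q < n"
  proof (rule minus_in_I)
    show "p \<in> V" "Suc q \<in> V" "y (Star q) \<in> carrier (H p (Suc q))"
      using p qn yu by auto
    show "conv (free_gen R [Arr q]) ?x \<in> carrier (H p (Suc q))"
      using q' qn by (intro conv_H[OF _ xH] free_gen_carrier) auto
    fix m assume m: "m < p" "Suc q + m \<le> n"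
    have "coord p (Suc q) m (conv (free_gen R [Arr q]) ?x) = coord p q m ?x"
      by (rule coord_conv_Arr) (use q' qn xH in auto)
    also have "\<dots> = U m"
    proof (cases "p \<le> q + m")
      case True
      then show ?thesis
        using coord_nform[of c p q m] p q m by (simp add: c_def)
    next
      case False
      \<comment> \<open>No path from p to q has m stars, so \<open>U m\<close> must vanish: for p =
        Suc q + m the cycle relation forces it, and for larger p no path to Suc q has m stars
        either.\<close>
      show ?thesis
      proof (cases "p = Suc q + m")
        case True
        then have "D (Suc m) = \<zero>"
          using r by (auto simp: D_def coord_empty)
        then have "U m = \<zero>"
          using DU_rel[of m] True m q' by simp
        then show ?thesis
          using False by (simp add: coord_empty)
      next
        case ne: False
        then show ?thesis
          using False by (simp add: U_def coord_empty)
      qed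
    qed
    also have "U m = coord p (Suc q) m (y (Star q))"
      using qn by (simp add: U_def)
    finally show "coord p (Suc q) m (y (Star q)) = coord p (Suc q) m (conv (free_gen R [Arr q]) ?x)"
      by simp
  qed
  have down: "(\<lambda>w. y (Arr r) w \<ominus> conv (free_gen R [Star r]) ?x w) \<in> I p r" if q1: "1 < q"
  proof (rule minus_in_I)
    note r = r[OF q1]
    have xH': "?x \<in> carrier (H p (Suc r))"
      using xH r by simp
    show "p \<in> V" "r \<in> V" "y (Arr r) \<in> carrier (H p r)"
      using p q1 r yd by auto
    show "conv (free_gen R [Star r]) ?x \<in> carrier (H p r)"
      using r by (intro conv_H[OF _ xH'] free_gen_carrier) auto
    fix m assume m: "m < p" "r + m \<le> n"
    have "D m = coord p r m (conv (free_gen R [Star r]) ?x)"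
    proof (cases m)
      case 0
      then show ?thesis
        using D0 coord_conv_Star(1)[OF r(2,3) xH'] by simp
    next
      case (Suc k)
      have "coord p r m (conv (free_gen R [Star r]) ?x) = sign (q + k - p) \<otimes> coord p q k ?x"
        unfolding Suc using coord_conv_Star(2)[OF r(2,3) xH', of k] r(1) by simp
      moreover have "D m = sign (q + k - p) \<otimes> coord p q k ?x"
      proof (cases "p \<le> q + k")
        case True
        then have x: "coord p q k ?x = c k"
          using coord_nform[of c p q k] p q m Suc r by simp
        show ?thesis
        proof (cases "q + k < n")
          case qk: True
          \<comment> \<open>The exponents Suc q + k - p and q + k - p differ by one, which turns the
            vanishing sum into an equality of the two terms.\<close>
          have "D (Suc k) \<oplus> \<ominus> (sign (q + k - p) \<otimes> U k) = \<zero>"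
            using DU_rel[of k] m Suc qk True by (simp add: Suc_diff_le sign_Suc l_minus)
          then have "D (Suc k) = sign (q + k - p) \<otimes> U k"
            using r_right_minus_eq by (simp add: a_minus_def)
          then show ?thesis
            using x qk Suc by (simp add: c_def)
        next
          case False
          \<comment> \<open>Now q + k = n, so \<open>c k\<close> was read off from
            \<open>D (Suc k)\<close> and the two signs cancel.\<close>
          then show ?thesis
            using x Suc by (simp add: c_def m_assoc[symmetric] sign_square)
        qed
      next
        case False
        then show ?thesis
          using Suc r by (simp add: D_def coord_empty)
      qed
      ultimately show ?thesis
        by simp
    qed
    then show "coord p r m (y (Arr r)) = coord p r m (conv (free_gen R [Star r]) ?x)"
      using q1 by (simp add: D_def)
  qed
  have "\<forall>b\<in>?A. (\<lambda>w. y b w \<ominus> conv (free_gen R [semitrans (\<Gamma>A n) b]) ?x w) \<in> I p (?t b)"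
  proof
    fix b assume b: "b \<in> ?A"
    have "1 < q \<and> b = Arr r \<or> q < n \<and> b = Star q"
      using b unfolding in_arcs_A[OF q'] r_def by (auto split: if_splits)
    then show "(\<lambda>w. y b w \<ominus> conv (free_gen R [semitrans (\<Gamma>A n) b]) ?x w) \<in> I p (?t b)"
      using up down by auto
  qed
  then show "\<exists>x\<in>carrier (H p (trans (\<Gamma>A n) q)). \<forall>b\<in>?A.
      (\<lambda>w. y b w \<ominus> conv (free_gen R [semitrans (\<Gamma>A n) b]) x w) \<in> I p (?t b)"
    unfolding trans_A(1) using xH by blast
qed

end

theorem theorem8p16:
  fixes R :: "('k, 'r) ring_scheme" and n :: nat
  assumes "cring R" and "\<one>\<^bsub>R\<^esub> \<noteq> \<zero>\<^bsub>R\<^esub>"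
    and "n \<ge> 2"
  shows "normal_quiver R (double_quiver (A_quiver n))"
proof -
  interpret type_A R n
    by (rule type_A.intro) fact
  show ?thesis
    unfolding normal_quiver_def using zero_mesh_homology by blast
qed

end
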